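(* Let $\mathfrak{g}$ be a Kac--Moody algebra over $\mathbb{C}$ and $V$ a highest weight $\mathfrak{g}$-module with highest weight $\lambda$. For each $J\subset I$ there exist sets $J_{\min}\subset J\subset J_{\max}\subset I$ such that for all $J'\subset I$: $$\operatorname{wt}_J V\subset \operatorname{wt}_{J'}V \iff J_{\min}\subset J',\qquad \operatorname{wt}_J V=\operatorname{wt}_{J'}V\iff J_{\min}\subset J'\subset J_{\max}.$$ In particular, in the poset $2^I$ under inclusion, the fibers of the map $\mathsf{F}_V(1,-)$ are intervals. Moreover, for each $J \subset I$, the fibers of the map $\mathsf{F}_V(-,J): W_{I_V}\to 2^{\operatorname{wt}V}$ are left cosets of $W_{I_V\cap J_{\max}}$ in $W_{I_V}$. Given the fact that an arbitrary face of $\operatorname{conv}V$ is in the $W_{I_V}$-orbit of a unique face of the form $\operatorname{conv} U(\mathfrak{l}_J)V_\lambda$, $J\subset I$, this determines the fibers of the map $\mathsf{F}_V(-,-)$.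
   Context: $I$ is a finite set, $A=(a_{ij})_{i,j\in I}$ a generalized Cartan matrix with realization $(\mathfrak{h},\{\alpha_i\},\{\check\alpha_i\})$ (with $\dim\mathfrak{h}=|I|+\operatorname{corank}(A)$, linearly independent simple roots $\alpha_i\in\mathfrak{h}^*$ and simple coroots $\check\alpha_i\in\mathfrak{h}$, $(\check\alpha_i,\alpha_j)=a_{ij}$), and $\mathfrak{g}$ is the Kac--Moody algebra generated by $\mathfrak{h}$ and Chevalley generators $e_i,f_i$, $i\in I$, with the usual relations including the Serre relations; $\mathfrak{g}=\mathfrak{n}^-\oplus\mathfrak{h}\oplus\mathfrak{n}^+$ is the triangular decomposition. $W$ is the Weyl group acting on $\mathfrak{h}^*$, generated by the simple reflections $s_i$, $i\in I$, and $W_J=\langle s_j:j\in J\rangle$ for $J\subset I$. $\mathfrak{l}_J$ is the subalgebra generated by $\mathfrak{h}$ and $e_j,f_j$, $j\in J$. A highest weight module of highest weight $\lambda\in\mathfrak{h}^*$ is one generated by a nonzero vector in the weight space $V_\lambda$ killed by $\mathfrak{n}^+$. $\operatorname{wt}M$ is the set of weights of an $\mathfrak{h}$-module $M$, and $\operatorname{conv}M$ is the convex hull of $\operatorname{wt}M$ in $\mathfrak{h}^*$ (regarded as a real vector space). A face of a convex set $C$ is a convex subset $F\subset C$ such that whenever a convex combination of points of $C$ lies in $F$, all those points lie in $F$. Set $\operatorname{wt}_J V:=\operatorname{wt} U(\mathfrak{l}_J)V_\lambda$ and $I_V:=\{i\in I:f_i\text{ acts locally nilpotently on }V\}$. The face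 map is $\mathsf{F}_V:W_{I_V}\times 2^I\to 2^{\operatorname{wt}V}$, $\mathsf{F}_V(w,J):=w(\operatorname{wt}_J V)$, where $2^X$ denotes the power set of $X$. *)

theory Defs
  imports
    "HOL-Analysis.Analysis"
    "HOL-Algebra.Bij"
    "HOL-Algebra.Coset"
    "HOL-Algebra.Generated_Groups"
    "HOL-Library.Function_Algebras"
begin

text \<open>
  Functions into a real vector space form a real vector space pointwise; this makes the library
  notions of convex hull and face available for subsets of the dual of the Cartan subalgebra.
\<close>

instantiation "fun" :: (type, real_vector) real_vector
begin

definition scaleR_fun :: "real \<Rightarrow> ('a \<Rightarrow> 'b) \<Rightarrow> 'a \<Rightarrow> 'b" where
  "scaleR_fun r f = (\<lambda>x. r *\<^sub>R f x)"

instance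
  by standard (auto simp: scaleR_fun_def fun_eq_iff scaleR_add_right scaleR_add_left)

end

section \<open>Lie algebras and presentations\<close>

locale complex_lie_algebra = vector_space scale
  for scale :: "complex \<Rightarrow> 'g::ab_group_add \<Rightarrow> 'g" +
  fixes bracket :: "'g \<Rightarrow> 'g \<Rightarrow> 'g"
  assumes bracket_add_left: "bracket (x + y) z = bracket x z + bracket y z"
    and bracket_add_right: "bracket x (y + z) = bracket x y + bracket x z"
    and bracket_scale_left: "bracket (scale c x) y = scale c (bracket x y)"
    and bracket_scale_right: "bracket x (scale c y) = scale c (bracket x y)"
    and bracket_self: "bracket x x = 0"
    and jacobi: "bracket x (bracket y z) + bracket y (bracket z x) + bracket z (bracket x y) = 0"

datatype 'x lie_term =
    Gen 'x
  | Zero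
  | Plus "'x lie_term" "'x lie_term"
  | Scale complex "'x lie_term"
  | Brk "'x lie_term" "'x lie_term"

text \<open>
  The quotient of the term algebra by the following congruence is the Lie algebra with generators
  in the type of labels and defining relations \<open>R\<close>.
\<close>

inductive lie_cong :: "('x lie_term \<times> 'x lie_term) set \<Rightarrow> 'x lie_term \<Rightarrow> 'x lie_term \<Rightarrow> bool"
  for R where
  rel: "(s, t) \<in> R \<Longrightarrow> lie_cong R s t"
| refl: "lie_cong R t t"
| sym: "lie_cong R s t \<Longrightarrow> lie_cong R t s"
| trans: "lie_cong R s t \<Longrightarrow> lie_cong R t u \<Longrightarrow> lie_cong R s u"
| Plus_cong: "lie_cong R s s' \<Longrightarrow> lie_cong R t t' \<Longrightarrow> lie_cong R (Plus s t) (Plus s' t')"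
| Scale_cong: "lie_cong R t t' \<Longrightarrow> lie_cong R (Scale c t) (Scale c t')"
| Brk_cong: "lie_cong R s s' \<Longrightarrow> lie_cong R t t' \<Longrightarrow> lie_cong R (Brk s t) (Brk s' t')"
| Plus_assoc: "lie_cong R (Plus (Plus s t) u) (Plus s (Plus t u))"
| Plus_comm: "lie_cong R (Plus s t) (Plus t s)"
| Plus_zero: "lie_cong R (Plus Zero t) t"
| Plus_inv: "lie_cong R (Plus (Scale (-1) t) t) Zero"
| Scale_one: "lie_cong R (Scale 1 t) t"
| Scale_Scale: "lie_cong R (Scale c (Scale d t)) (Scale (c * d) t)"
| Scale_add: "lie_cong R (Scale (c + d) t) (Plus (Scale c t) (Scale d t))"
| Scale_Plus: "lie_cong R (Scale c (Plus s t)) (Plus (Scale c s) (Scale c t))"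
| Brk_Plus_left: "lie_cong R (Brk (Plus s t) u) (Plus (Brk s u) (Brk t u))"
| Brk_Plus_right: "lie_cong R (Brk s (Plus t u)) (Plus (Brk s t) (Brk s u))"
| Brk_Scale_left: "lie_cong R (Brk (Scale c s) t) (Scale c (Brk s t))"
| Brk_Scale_right: "lie_cong R (Brk s (Scale c t)) (Scale c (Brk s t))"
| Brk_self: "lie_cong R (Brk t t) Zero"
| Brk_jacobi: "lie_cong R (Plus (Plus (Brk s (Brk t u)) (Brk t (Brk u s))) (Brk u (Brk s t))) Zero"

primrec lie_eval ::
  "(complex \<Rightarrow> 'g \<Rightarrow> 'g) \<Rightarrow> ('g \<Rightarrow> 'g \<Rightarrow> 'g) \<Rightarrow> ('x \<Rightarrow> 'g) \<Rightarrow> 'x lie_term \<Rightarrow> 'g::ab_group_add" where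
  "lie_eval sc br \<gamma> (Gen x) = \<gamma> x"
| "lie_eval sc br \<gamma> Zero = 0"
| "lie_eval sc br \<gamma> (Plus s t) = lie_eval sc br \<gamma> s + lie_eval sc br \<gamma> t"
| "lie_eval sc br \<gamma> (Scale c t) = sc c (lie_eval sc br \<gamma> t)"
| "lie_eval sc br \<gamma> (Brk s t) = br (lie_eval sc br \<gamma> s) (lie_eval sc br \<gamma> t)"

definition lie_presented ::
  "(complex \<Rightarrow> 'g \<Rightarrow> 'g) \<Rightarrow> ('g \<Rightarrow> 'g \<Rightarrow> 'g) \<Rightarrow> ('x \<Rightarrow> 'g::ab_group_add) \<Rightarrow>
    ('x lie_term \<times> 'x lie_term) set \<Rightarrow> bool" where
  "lie_presented sc br \<gamma> R \<longleftrightarrow>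
     range (lie_eval sc br \<gamma>) = UNIV \<and>
     (\<forall>s t. lie_eval sc br \<gamma> s = lie_eval sc br \<gamma> t \<longleftrightarrow> lie_cong R s t)"

section \<open>Kac--Moody algebras\<close>

text \<open>
  The type \<open>'i\<close> is the index set $I$, \<open>'h\<close> the Cartan subalgebra, \<open>'g\<close> the Lie algebra;
  \<open>cartan_incl\<close> is the canonical map of the Cartan subalgebra into the Lie algebra.
\<close>

record ('i, 'h, 'g) kac_moody_data =
  cartan_matrix :: "'i \<Rightarrow> 'i \<Rightarrow> int"
  hscale :: "complex \<Rightarrow> 'h \<Rightarrow> 'h"
  simple_root :: "'i \<Rightarrow> 'h \<Rightarrow> complex"
  simple_coroot :: "'i \<Rightarrow> 'h"
  gscale :: "complex \<Rightarrow> 'g \<Rightarrow> 'g"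
  bracket :: "'g \<Rightarrow> 'g \<Rightarrow> 'g"
  cartan_incl :: "'h \<Rightarrow> 'g"
  chev_e :: "'i \<Rightarrow> 'g"
  chev_f :: "'i \<Rightarrow> 'g"

definition generalized_cartan_matrix :: "('i \<Rightarrow> 'i \<Rightarrow> int) \<Rightarrow> bool" where
  "generalized_cartan_matrix A \<longleftrightarrow>
     (\<forall>i. A i i = 2) \<and>
     (\<forall>i j. i \<noteq> j \<longrightarrow> A i j \<le> 0) \<and>
     (\<forall>i j. A i j = 0 \<longleftrightarrow> A j i = 0)"

definition corank :: "('i::finite \<Rightarrow> 'i \<Rightarrow> int) \<Rightarrow> nat" where
  "corank A = CARD('i) - rank ((\<chi> i j. of_int (A i j)) :: complex^'i^'i)"

definition hdual :: "('i, 'h::ab_group_add, 'g) kac_moody_data \<Rightarrow> ('h \<Rightarrow> complex) set" where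
  "hdual K = {\<mu>. Vector_Spaces.linear (hscale K) (*) \<mu>}"

text \<open>
  Finite dimensionality is stated separately because the library's dimension of an
  infinite-dimensional space is 0. Injectivity makes independence of the ranges independence of
  the families.
\<close>

definition realization :: "('i::finite, 'h::ab_group_add, 'g) kac_moody_data \<Rightarrow> bool" where
  "realization K \<longleftrightarrow>
     vector_space (hscale K) \<and>
     (\<exists>B. finite B \<and> module.span (hscale K) B = UNIV) \<and>
     vector_space.dim (hscale K) UNIV = CARD('i) + corank (cartan_matrix K) \<and>
     range (simple_root K) \<subseteq> hdual K \<and>
     inj (simple_root K) \<and>
     \<not> module.dependent (\<lambda>c \<mu> h. c * \<mu> h) (range (simple_root K)) \<and>
     inj (simple_coroot K) \<and>
     \<not> module.dependent (hscale K) (range (simple_coroot K)) \<and>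
     (\<forall>i j. simple_root K j (simple_coroot K i) = of_int (cartan_matrix K i j))"

datatype ('i, 'h) km_gen = Gen_h 'h | Gen_e 'i | Gen_f 'i

inductive_set km_relations ::
  "('i, 'h::ab_group_add, 'g) kac_moody_data \<Rightarrow>
     (('i, 'h) km_gen lie_term \<times> ('i, 'h) km_gen lie_term) set"
  for K where
  H_add: "(Gen (Gen_h (h + h')), Plus (Gen (Gen_h h)) (Gen (Gen_h h'))) \<in> km_relations K"
| H_scale: "(Gen (Gen_h (hscale K c h)), Scale c (Gen (Gen_h h))) \<in> km_relations K"
| H_H: "(Brk (Gen (Gen_h h)) (Gen (Gen_h h')), Zero) \<in> km_relations K"
| E_F_same: "(Brk (Gen (Gen_e i)) (Gen (Gen_f i)), Gen (Gen_h (simple_coroot K i))) \<in> km_relations K"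
| E_F_diff: "i \<noteq> j \<Longrightarrow> (Brk (Gen (Gen_e i)) (Gen (Gen_f j)), Zero) \<in> km_relations K"
| H_E: "(Brk (Gen (Gen_h h)) (Gen (Gen_e i)), Scale (simple_root K i h) (Gen (Gen_e i))) \<in> km_relations K"
| H_F: "(Brk (Gen (Gen_h h)) (Gen (Gen_f i)), Scale (- simple_root K i h) (Gen (Gen_f i))) \<in> km_relations K"
| Serre_E: "i \<noteq> j \<Longrightarrow>
    ((Brk (Gen (Gen_e i)) ^^ nat (1 - cartan_matrix K i j)) (Gen (Gen_e j)), Zero) \<in> km_relations K"
| Serre_F: "i \<noteq> j \<Longrightarrow>
    ((Brk (Gen (Gen_f i)) ^^ nat (1 - cartan_matrix K i j)) (Gen (Gen_f j)), Zero) \<in> km_relations K"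

primrec km_gen_eval :: "('i, 'h, 'g) kac_moody_data \<Rightarrow> ('i, 'h) km_gen \<Rightarrow> 'g" where
  "km_gen_eval K (Gen_h h) = cartan_incl K h"
| "km_gen_eval K (Gen_e i) = chev_e K i"
| "km_gen_eval K (Gen_f i) = chev_f K i"

definition kac_moody_algebra ::
  "('i::finite, 'h::ab_group_add, 'g::ab_group_add) kac_moody_data \<Rightarrow> bool" where
  "kac_moody_algebra K \<longleftrightarrow>
     generalized_cartan_matrix (cartan_matrix K) \<and>
     realization K \<and>
     complex_lie_algebra (gscale K) (bracket K) \<and>
     lie_presented (gscale K) (bracket K) (km_gen_eval K) (km_relations K)"

definition lie_subalgebra :: "('i, 'h, 'g::ab_group_add) kac_moody_data \<Rightarrow> 'g set \<Rightarrow> bool" where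
  "lie_subalgebra K L \<longleftrightarrow>
     module.subspace (gscale K) L \<and> (\<forall>x\<in>L. \<forall>y\<in>L. bracket K x y \<in> L)"

definition n_plus :: "('i, 'h, 'g::ab_group_add) kac_moody_data \<Rightarrow> 'g set" where
  "n_plus K = lie_subalgebra K hull range (chev_e K)"

definition levi :: "('i, 'h, 'g::ab_group_add) kac_moody_data \<Rightarrow> 'i set \<Rightarrow> 'g set" where
  "levi K J = lie_subalgebra K hull (range (cartan_incl K) \<union> chev_e K ` J \<union> chev_f K ` J)"

text \<open>
  The Weyl group acts faithfully on the dual of the Cartan subalgebra, so its elements are
  represented as (extensional) bijections of that set.
\<close>

definition simple_refl ::
  "('i, 'h::ab_group_add, 'g) kac_moody_data \<Rightarrow> 'i \<Rightarrow> ('h \<Rightarrow> complex) \<Rightarrow> 'h \<Rightarrow> complex" where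
  "simple_refl K i =
     (\<lambda>\<mu>\<in>hdual K. \<lambda>h. \<mu> h - \<mu> (simple_coroot K i) * simple_root K i h)"

definition weyl_parabolic ::
  "('i, 'h::ab_group_add, 'g) kac_moody_data \<Rightarrow> 'i set \<Rightarrow>
     (('h \<Rightarrow> complex) \<Rightarrow> 'h \<Rightarrow> complex) set" where
  "weyl_parabolic K J = generate (BijGroup (hdual K)) (simple_refl K ` J)"

section \<open>Highest weight modules and the face map\<close>

record ('g, 'v) lie_module =
  mscale :: "complex \<Rightarrow> 'v \<Rightarrow> 'v"
  act :: "'g \<Rightarrow> 'v \<Rightarrow> 'v"

definition g_module ::
  "('i, 'h, 'g::ab_group_add) kac_moody_data \<Rightarrow> ('g, 'v::ab_group_add) lie_module \<Rightarrow> bool" where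
  "g_module K V \<longleftrightarrow>
     vector_space (mscale V) \<and>
     (\<forall>x. Vector_Spaces.linear (mscale V) (mscale V) (act V x)) \<and>
     (\<forall>v. Vector_Spaces.linear (gscale K) (mscale V) (\<lambda>x. act V x v)) \<and>
     (\<forall>x y v. act V (bracket K x y) v = act V x (act V y v) - act V y (act V x v))"

definition weight_space ::
  "('i, 'h, 'g) kac_moody_data \<Rightarrow> ('g, 'v) lie_module \<Rightarrow> ('h \<Rightarrow> complex) \<Rightarrow> 'v set" where
  "weight_space K V \<mu> = {v. \<forall>h. act V (cartan_incl K h) v = mscale V (\<mu> h) v}"

text \<open>The weights of a subspace \<open>M\<close> of the module.\<close>

definition wt ::
  "('i, 'h::ab_group_add, 'g) kac_moody_data \<Rightarrow> ('g, 'v::ab_group_add) lie_module \<Rightarrow>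
     'v set \<Rightarrow> ('h \<Rightarrow> complex) set" where
  "wt K V M = {\<mu> \<in> hdual K. \<exists>v \<in> M. v \<noteq> 0 \<and> v \<in> weight_space K V \<mu>}"

text \<open>
  For a Lie subalgebra \<open>L\<close>, the space $U(L)X$: the enveloping algebra is spanned by the monomials
  $x_1 \cdots x_k$ with $x_i$ in \<open>L\<close>.
\<close>

definition U_apply :: "('g, 'v::ab_group_add) lie_module \<Rightarrow> 'g set \<Rightarrow> 'v set \<Rightarrow> 'v set" where
  "U_apply V L X = module.span (mscale V) {foldr (act V) xs v | xs v. set xs \<subseteq> L \<and> v \<in> X}"

definition highest_weight_module ::
  "('i, 'h::ab_group_add, 'g::ab_group_add) kac_moody_data \<Rightarrow>
     ('g, 'v::ab_group_add) lie_module \<Rightarrow> ('h \<Rightarrow> complex) \<Rightarrow> bool" where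
  "highest_weight_module K V \<Lambda> \<longleftrightarrow>
     g_module K V \<and> \<Lambda> \<in> hdual K \<and>
     (\<exists>v. v \<noteq> 0 \<and> v \<in> weight_space K V \<Lambda> \<and> (\<forall>x \<in> n_plus K. act V x v = 0) \<and>
          U_apply V UNIV {v} = UNIV)"

definition wt_J ::
  "('i, 'h::ab_group_add, 'g::ab_group_add) kac_moody_data \<Rightarrow>
     ('g, 'v::ab_group_add) lie_module \<Rightarrow> ('h \<Rightarrow> complex) \<Rightarrow> 'i set \<Rightarrow> ('h \<Rightarrow> complex) set" where
  "wt_J K V \<Lambda> J = wt K V (U_apply V (levi K J) (weight_space K V \<Lambda>))"

definition integrable_nodes ::
  "('i, 'h, 'g) kac_moody_data \<Rightarrow> ('g, 'v::ab_group_add) lie_module \<Rightarrow> 'i set" where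
  "integrable_nodes K V = {i. \<forall>v. \<exists>n. (act V (chev_f K i) ^^ n) v = 0}"

definition face_map ::
  "('i, 'h::ab_group_add, 'g::ab_group_add) kac_moody_data \<Rightarrow>
     ('g, 'v::ab_group_add) lie_module \<Rightarrow> ('h \<Rightarrow> complex) \<Rightarrow>
     (('h \<Rightarrow> complex) \<Rightarrow> 'h \<Rightarrow> complex) \<times> 'i set \<Rightarrow> ('h \<Rightarrow> complex) set" where
  "face_map K V \<Lambda> = (\<lambda>(w, J). w ` wt_J K V \<Lambda> J)"

text \<open>
  \<open>conv K V M\<close> is the convex hull of the weights of \<open>M\<close>; it lies in \<open>hdual K\<close>, a real subspace of
  the space of all functions.
\<close>

definition conv ::
  "('i, 'h::ab_group_add, 'g) kac_moody_data \<Rightarrow> ('g, 'v::ab_group_add) lie_module \<Rightarrow>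
     'v set \<Rightarrow> ('h \<Rightarrow> complex) set" where
  "conv K V M = convex hull (wt K V M)"

text \<open>
  Every nonempty face of $\mathrm{conv}\,V$ is in the orbit, under the parabolic subgroup attached
  to the integrable nodes, of a unique face of the form $\mathrm{conv}\,U(\mathfrak{l}_J)V_\lambda$.
  The empty set, a \<open>face_of\<close> every set, has to be excluded.
\<close>

definition faces_conjugate_to_standard ::
  "('i, 'h::ab_group_add, 'g::ab_group_add) kac_moody_data \<Rightarrow>
     ('g, 'v::ab_group_add) lie_module \<Rightarrow> ('h \<Rightarrow> complex) \<Rightarrow> bool" where
  "faces_conjugate_to_standard K V \<Lambda> \<longleftrightarrow>
     (\<forall>\<Phi>. \<Phi> face_of conv K V UNIV \<and> \<Phi> \<noteq> {} \<longrightarrow>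
       (\<exists>!G. G face_of conv K V UNIV \<and>
             (\<exists>J. G = conv K V (U_apply V (levi K J) (weight_space K V \<Lambda>))) \<and>
             (\<exists>w \<in> weyl_parabolic K (integrable_nodes K V). \<Phi> = w ` G)))"

end

theory Submission
  imports Defs
begin

text \<open>
  Everything reduces to monomials in the $f_i$. Applied to the highest weight vector $v$, they span
  $V$, and those with indices in $J$ span $U(\mathfrak l_J)V_\lambda$; hence the weights of
  $U(\mathfrak l_J)V_\lambda$ are the $\lambda - \sum_k \alpha_{i_k}$ for which all $i_k$ lie in $J$
  and $f_{i_1}\cdots f_{i_n}v \neq 0$ (\<open>wt_J_eq\<close>). By independence of the simple roots such a weight
  determines the set of indices it uses. So $J_{\min}$ is the set of indices used by some
  weight in $\mathrm{wt}_J V$. A node $t$ is put into $J_{\max}$ if adding it to $J_{\min}$ produces no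
  new weight. Adding several such nodes at once produces none either: read a nonvanishing
  monomial from the right up to the first index outside $J_{\min}$; this suffix already
  lives over $J_{\min}$ and that single node (\<open>supp_below_Jmax\<close>).

  The weights of $V$ are stable under the reflections $s_i$ with $f_i$ locally nilpotent, by
  $\mathfrak{sl}_2$-theory (\<open>refl_weight\<close>). For $i \in I_V \cap J_{\max}$ the reflection $s_i$ therefore
  preserves $\mathrm{wt}_J V = \mathrm{wt}_{J_{\max}} V$, since it changes only the coefficient of
  $\alpha_i$.

  Conversely, let $w \in W_{I_V}$ map $\mathrm{wt}_J V$ onto $\mathrm{wt}_{J'} V$ and suppose
  $w\alpha_i$ is a nonpositive combination of simple roots. Then $i \in J_{\max}$: otherwise some
  $\mu \in \mathrm{wt}_J V$ has $\mu - \alpha_i \in \mathrm{wt}\,V$, and $w(\mu-\alpha_i) = w\mu - w\alpha_i$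
  is a weight lying above $w\mu \in \mathrm{wt}_{J'} V$, so it uses only nodes of $J'$ and belongs to
  $\mathrm{wt}_{J'} V = w(\mathrm{wt}_J V)$. Hence $\mu - \alpha_i \in \mathrm{wt}_J V$, which forces
  $i \in J \subset J_{\max}$ (\<open>nonpos_image_in_Jmax\<close>). The last letter of a reduced word for $w$ has
  such a nonpositive image (\<open>descent_nonpos\<close>), so it can be removed, and by induction on the length
  $w \in W_{I_V \cap J_{\max}}$ (\<open>stabilizer_word\<close>). In particular $\mathrm{wt}_{J'} V = \mathrm{wt}_J V$,
  which determines the fibers in both variables at once (\<open>fibre\<close>).

  The fact about reduced words is proved inside the reflection representation, by Deodhar's
  reduction to rank two (\<open>ascent_nonneg\<close>).
\<close>

section \<open>The Weyl group acting on functions\<close>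

text \<open>
  The reflections make sense on all functions on \<open>'h\<close>, linear or not, because they only evaluate a
  function at a simple coroot. Elements of the Weyl group are handled as words in the simple
  reflections, and two words are compared through their action on all functions.
\<close>

locale root_datum =
  fixes A :: "'i::finite \<Rightarrow> 'i \<Rightarrow> int"
    and \<alpha> :: "'i \<Rightarrow> 'h \<Rightarrow> complex"
    and coroot :: "'i \<Rightarrow> 'h"
  assumes gcm: "generalized_cartan_matrix A"
    and pairing: "\<alpha> j (coroot i) = of_int (A i j)"
    and indep: "(\<And>h. (\<Sum>k\<in>UNIV. c k * \<alpha> k h) = 0) \<Longrightarrow> c k = 0"
begin

definition refl :: "'i \<Rightarrow> ('h \<Rightarrow> complex) \<Rightarrow> 'h \<Rightarrow> complex" where
  "refl i \<mu> = (\<lambda>h. \<mu> h - \<mu> (coroot i) * \<alpha> i h)"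

definition word :: "'i list \<Rightarrow> ('h \<Rightarrow> complex) \<Rightarrow> 'h \<Rightarrow> complex" where
  "word is = foldr refl is"

definition root_comb :: "('i \<Rightarrow> int) \<Rightarrow> 'h \<Rightarrow> complex" where
  "root_comb c = (\<lambda>h. \<Sum>k\<in>UNIV. of_int (c k) * \<alpha> k h)"

lemma A_diag [simp]: "A i i = 2"
  using gcm by (simp add: generalized_cartan_matrix_def)

lemma refl_root_self: "refl i (\<alpha> i) = - \<alpha> i"
  by (simp add: refl_def pairing fun_eq_iff)

lemma refl_refl [simp]: "refl i (refl i \<mu>) = \<mu>"
  by (simp add: refl_def fun_eq_iff pairing algebra_simps)

lemma word_Nil [simp]: "word [] \<mu> = \<mu>"
  and word_Cons [simp]: "word (i # u) \<mu> = refl i (word u \<mu>)"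
  and word_append [simp]: "word (u @ t) \<mu> = word u (word t \<mu>)"
  by (simp_all add: word_def)

lemma word_rev [simp]: "word (rev u) (word u \<mu>) = \<mu>"
  by (induction u arbitrary: \<mu>) auto

lemma word_rev' [simp]: "word u (word (rev u) \<mu>) = \<mu>"
  using word_rev[of "rev u" \<mu>] by simp

lemma word_inj: "word u \<mu> = word u \<nu> \<Longrightarrow> \<mu> = \<nu>"
  by (metis word_rev)

lemma refl_linear: "refl i (\<lambda>h. c * \<mu> h + d * \<nu> h) = (\<lambda>h. c * refl i \<mu> h + d * refl i \<nu> h)"
  by (simp add: refl_def fun_eq_iff algebra_simps)

lemma word_linear: "word u (\<lambda>h. c * \<mu> h + d * \<nu> h) = (\<lambda>h. c * word u \<mu> h + d * word u \<nu> h)"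
  by (induction u) (simp_all add: refl_linear)

lemma word_minus: "word u (- \<mu>) = - word u \<mu>"
  using word_linear[of u "-1" \<mu> 0 \<mu>] by (simp add: fun_Compl_def)

lemma word_diff: "word u (\<mu> - \<nu>) = word u \<mu> - word u \<nu>"
  using word_linear[of u 1 \<mu> "-1" \<nu>] by (simp add: fun_diff_def)

lemma root_comb_inj: "root_comb c = root_comb d \<Longrightarrow> c = d"
proof
  fix k
  assume eq: "root_comb c = root_comb d"
  have "(\<Sum>k\<in>UNIV. (of_int (c k) - of_int (d k)) * \<alpha> k h) = 0" for h
    using fun_cong[OF eq, of h]
    by (simp add: root_comb_def algebra_simps sum_subtractf)
  from indep[OF this, of k] show "c k = d k" by simp
qed

lemma root_comb_add: "root_comb (\<lambda>k. c k + d k) = root_comb c + root_comb d"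
  by (simp add: root_comb_def fun_eq_iff sum.distrib algebra_simps)

lemma root_comb_diff: "root_comb (\<lambda>k. c k - d k) = root_comb c - root_comb d"
  by (simp add: root_comb_def fun_eq_iff sum_subtractf algebra_simps)

lemma root_comb_single: "root_comb (\<lambda>k. if k = i then n else 0) = (\<lambda>h. of_int n * \<alpha> i h)"
proof
  fix h
  have "(\<Sum>k\<in>UNIV. of_int (if k = i then n else 0) * \<alpha> k h)
      = (\<Sum>k\<in>UNIV. if k = i then of_int n * \<alpha> k h else 0)"
    by (rule sum.cong) auto
  then show "root_comb (\<lambda>k. if k = i then n else 0) h = of_int n * \<alpha> i h"
    by (simp add: root_comb_def)
qed

lemma root_comb_zero [simp]: "root_comb (\<lambda>_. 0) = 0"
  by (simp add: root_comb_def fun_eq_iff)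

definition nonneg :: "('h \<Rightarrow> complex) \<Rightarrow> bool" where
  "nonneg \<beta> \<longleftrightarrow> (\<exists>c. (\<forall>k. 0 \<le> c k) \<and> \<beta> = root_comb c)"

lemma nonneg_root: "nonneg (\<alpha> i)"
  unfolding nonneg_def
  by (intro exI[of _ "\<lambda>k. if k = i then 1 else 0"]) (simp add: root_comb_single)

lemma nonneg_comb:
  assumes "nonneg \<beta>" "nonneg \<gamma>" "0 \<le> c" "0 \<le> d"
  shows "nonneg (\<lambda>h. of_int c * \<beta> h + of_int d * \<gamma> h)"
proof -
  obtain p q where "\<forall>k. 0 \<le> p k" "\<beta> = root_comb p" "\<forall>k. 0 \<le> q k" "\<gamma> = root_comb q"
    using assms(1,2) unfolding nonneg_def by blast
  then have "(\<lambda>h. of_int c * \<beta> h + of_int d * \<gamma> h) = root_comb (\<lambda>k. c * p k + d * q k)"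
    by (simp add: root_comb_def fun_eq_iff sum.distrib algebra_simps sum_distrib_left)
  with assms \<open>\<forall>k. 0 \<le> p k\<close> \<open>\<forall>k. 0 \<le> q k\<close> show ?thesis
    unfolding nonneg_def by (metis add_nonneg_nonneg mult_nonneg_nonneg)
qed

section \<open>Rank two\<close>

text \<open>The word of length \<open>p\<close> in which \<open>i\<close> and \<open>j\<close> alternate and whose last letter is \<open>j\<close>.\<close>

primrec alt :: "nat \<Rightarrow> 'i \<Rightarrow> 'i \<Rightarrow> 'i list" where
  "alt 0 i j = []"
| "alt (Suc p) i j = alt p j i @ [j]"

lemma length_alt [simp]: "length (alt p i j) = p"
  by (induction p arbitrary: i j) auto

lemma set_alt: "set (alt p i j) \<subseteq> {i, j}"
  by (induction p arbitrary: i j) fastforce+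

lemma alt_Suc_left: "alt (Suc p) i j = (if even p then j else i) # alt p i j"
proof (induction p arbitrary: i j)
  case (Suc p)
  have "alt (Suc (Suc p)) i j = alt (Suc p) j i @ [j]" by simp
  also have "\<dots> = (if even p then i else j) # alt (Suc p) i j"
    by (subst Suc.IH) simp
  finally show ?case by simp
qed simp

lemma alt_split: "m \<le> p \<Longrightarrow> \<exists>y. alt p i j = y @ alt m i j"
proof (induction p)
  case (Suc p)
  show ?case
  proof (cases "m = Suc p")
    case False
    with Suc obtain y where "alt p i j = y @ alt m i j" by (metis le_SucE)
    then show ?thesis by (metis alt_Suc_left append_Cons)
  qed auto
qed auto

text \<open>
  A coset of the plane spanned by two simple roots, in coordinates; both reflections preserve it.
\<close>

definition lin :: "'i \<Rightarrow> 'i \<Rightarrow> ('h \<Rightarrow> complex) \<Rightarrow> complex \<Rightarrow> complex \<Rightarrow> 'h \<Rightarrow> complex" where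
  "lin i j \<mu> c d = (\<lambda>h. \<mu> h + c * \<alpha> i h + d * \<alpha> j h)"

lemma lin_swap: "lin i j \<mu> c d = lin j i \<mu> d c"
  by (simp add: lin_def fun_eq_iff)

lemma refl_lin:
  "refl i (lin i j \<mu> c d) = lin i j \<mu> (- \<mu> (coroot i) - c - of_int (A i j) * d) d"
  "refl j (lin i j \<mu> c d) = lin i j \<mu> c (- \<mu> (coroot j) - d - of_int (A j i) * c)"
  by (simp_all add: lin_def refl_def fun_eq_iff pairing algebra_simps)

lemma refl_lin_0:
  "refl i (lin i j 0 c d) = lin i j 0 (- c - of_int (A i j) * d) d"
  "refl j (lin i j 0 c d) = lin i j 0 c (- d - of_int (A j i) * c)"
  by (simp_all add: refl_lin)

text \<open>
  In the infinite rank two case the coefficients of $\alpha_i, \alpha_j$ never decrease along the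
  alternating word: the last hypothesis says that reflecting in \<open>j\<close> does not decrease the coefficient of
  $\alpha_j$, and $a_{ij}a_{ji} \ge 4$ carries it over, with \<open>i\<close> and \<open>j\<close> exchanged, to the next letter.
\<close>

lemma alt_infinite:
  assumes "A i j * A j i \<ge> 4" "A i j \<le> 0" "A j i \<le> 0" "0 \<le> c" "0 \<le> d" "2 * d \<le> - A j i * c"
  shows "\<exists>c' d'. 0 \<le> c' \<and> 0 \<le> d' \<and>
    word (alt p i j) (lin i j 0 (of_int c) (of_int d)) = lin i j 0 (of_int c') (of_int d')"
  using assms
proof (induction p arbitrary: i j c d)
  case 0
  then show ?case by auto
next
  case (Suc p)
  let ?d = "- d - A j i * c"
  have d: "0 \<le> ?d" "d \<le> ?d" using Suc.prems by linarith+
  have "2 * c \<le> - A i j * ?d"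
  proof -
    have "- A i j * (2 * d) \<le> - A i j * (- A j i * c)"
      using Suc.prems by (intro mult_left_mono) auto
    moreover have "4 * c \<le> A i j * A j i * c"
      using Suc.prems by (intro mult_right_mono) auto
    ultimately show ?thesis by (simp add: algebra_simps)
  qed
  moreover have "A j i * A i j \<ge> 4"
    using Suc.prems(1) by (simp add: mult.commute)
  ultimately have "\<exists>c' d'. 0 \<le> c' \<and> 0 \<le> d' \<and>
      word (alt p j i) (lin j i 0 (of_int ?d) (of_int c)) = lin j i 0 (of_int c') (of_int d')"
    using Suc.prems d by (intro Suc.IH) auto
  then obtain c' d' where
    "0 \<le> c'" "0 \<le> d'"
    "word (alt p j i) (lin j i 0 (of_int ?d) (of_int c)) = lin j i 0 (of_int c') (of_int d')"
    by blast
  then have "word (alt (Suc p) i j) (lin i j 0 (of_int c) (of_int d)) = lin i j 0 (of_int d') (of_int c')"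
    using refl_lin_0(2)[of j i "of_int c" "of_int d"] by (simp add: lin_swap[of j i])
  with \<open>0 \<le> c'\<close> \<open>0 \<le> d'\<close> show ?case by blast
qed

text \<open>
  The triples list the finite types $A_1\times A_1$, $A_2$, $B_2$, $G_2$ with the order \<open>m\<close> of
  $s_is_j$.
\<close>

lemma braid:
  assumes "(A i j, A j i, m) \<in>
    {(0, 0, 2), (-1, -1, 3), (-1, -2, 4), (-2, -1, 4), (-1, -3, 6), (-3, -1, 6)}"
  shows "word (alt m i j) = word (alt m j i)"
proof
  fix \<mu>
  have "word (alt m i j) (lin i j \<mu> 0 0) = word (alt m j i) (lin i j \<mu> 0 0)"
    using assms
    by (elim insertE emptyE Pair_inject; simp add: numeral_eq_Suc refl_lin; simp add: lin_def algebra_simps)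
  then show "word (alt m i j) \<mu> = word (alt m j i) \<mu>"
    by (simp add: lin_def)
qed

lemma alt_finite:
  assumes "(A i j, A j i, m) \<in>
    {(0, 0, 2), (-1, -1, 3), (-1, -2, 4), (-2, -1, 4), (-1, -3, 6), (-3, -1, 6)}"
    and "p < m"
  shows "\<exists>c d. 0 \<le> c \<and> 0 \<le> d \<and>
    word (alt p i j) (lin i j 0 1 0) = lin i j 0 (of_int c) (of_int d)"
proof -
  have "p \<in> {0, 1, 2, 3, 4, 5}" using assms by auto
  with assms have "\<exists>x\<in>{0, 1, 2, 3}. \<exists>y\<in>{0, 1, 2, 3}. word (alt p i j) (lin i j 0 1 0) = lin i j 0 x y"
    by (elim insertE emptyE Pair_inject; simp add: numeral_eq_Suc refl_lin_0)
  then obtain x y where xy: "x \<in> {0, 1, 2, 3}" "y \<in> {0, 1, 2, 3}"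
    "word (alt p i j) (lin i j 0 1 0) = lin i j 0 x y" by blast
  have nat: "\<exists>c\<ge>0. z = of_int c" if "z \<in> {0, 1, 2, 3}" for z :: complex
    using that by (auto intro: exI[of _ 0] exI[of _ 1] exI[of _ 2] exI[of _ 3])
  obtain c d where "0 \<le> c" "x = of_int c" "0 \<le> d" "y = of_int d"
    using nat[OF xy(1)] nat[OF xy(2)] by blast
  with xy(3) show ?thesis by auto
qed

text \<open>
  The image of $\alpha_i$ under a word ending in $s_j$ stays nonnegative until the word is long enough
  to contain one side of a braid relation, and then the word can be rewritten to end in $s_i$.
\<close>

lemma alt_root:
  assumes "i \<noteq> j"
  shows "(\<exists>c d. 0 \<le> c \<and> 0 \<le> d \<and>
      word (alt p i j) (\<alpha> i) = lin i j 0 (of_int c) (of_int d)) \<or>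
    (\<exists>m. 1 \<le> m \<and> m \<le> p \<and> word (alt m i j) = word (alt m j i))"
proof -
  have start: "\<alpha> i = lin i j 0 1 0" by (simp add: lin_def)
  have nonpos: "A i j \<le> 0" "A j i \<le> 0" and zero: "A i j = 0 \<longleftrightarrow> A j i = 0"
    using gcm assms unfolding generalized_cartan_matrix_def by auto
  show ?thesis
  proof (cases "A i j * A j i \<ge> 4")
    case True
    from alt_infinite[OF this nonpos, of 1 0 p] nonpos show ?thesis by (simp add: start)
  next
    case False
    have "\<exists>m. (A i j, A j i, m) \<in>
      {(0, 0, 2), (-1, -1, 3), (-1, -2, 4), (-2, -1, 4), (-1, -3, 6), (-3, -1, 6::nat)}"
    proof (cases "A i j = 0")
      case True
      with zero show ?thesis by auto
    next
      case nz: False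
      define a b where "a = - A i j" and "b = - A j i"
      have ab: "a \<ge> 1" "b \<ge> 1" "a * b \<le> 3" using False nz nonpos zero by (auto simp: a_def b_def)
      have "a * 1 \<le> a * b" "1 * b \<le> a * b" using ab by (intro mult_left_mono mult_right_mono; simp)+
      with ab have "a = 1 \<or> a = 2 \<or> a = 3" "b = 1 \<or> b = 2 \<or> b = 3" by linarith+
      with ab have "(a, b) \<in> {(1,1),(1,2),(2,1),(1,3),(3,1)}" by auto
      then have "(- a, - b) \<in> {(-1,-1),(-1,-2),(-2,-1),(-1,-3),(-3,-1)}" by auto
      then show ?thesis by (auto simp: a_def b_def)
    qed
    then obtain m :: nat where m: "(A i j, A j i, m) \<in>
      {(0, 0, 2), (-1, -1, 3), (-1, -2, 4), (-2, -1, 4), (-1, -3, 6), (-3, -1, 6)}" by blast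
    show ?thesis
    proof (cases "p < m")
      case True
      from alt_finite[OF m this] show ?thesis by (simp add: start)
    next
      case False
      have "1 \<le> m" using m by auto
      with False braid[OF m] show ?thesis by auto
    qed
  qed
qed

section \<open>Reduced words and nonnegative roots\<close>

definition wlen :: "'i set \<Rightarrow> 'i list \<Rightarrow> nat" where
  "wlen L u = (LEAST n. \<exists>t\<in>lists L. length t = n \<and> word t = word u)"

lemma wlen_cong: "word u = word t \<Longrightarrow> wlen L u = wlen L t"
  by (simp add: wlen_def)

lemma wlen_le: "u \<in> lists L \<Longrightarrow> wlen L u \<le> length u"
  unfolding wlen_def by (rule Least_le) auto

lemma reduced_word:
  assumes "u \<in> lists L"
  obtains t where "t \<in> lists L" "length t = wlen L u" "word t = word u"
proof -
  have "\<exists>t\<in>lists L. length t = wlen L u \<and> word t = word u"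
    unfolding wlen_def by (rule LeastI_ex) (use assms in auto)
  with that show thesis by blast
qed

lemma wlen_append_le:
  assumes "u \<in> lists L" "t \<in> lists L"
  shows "wlen L (u @ t) \<le> wlen L u + length t"
proof -
  obtain u' where u': "u' \<in> lists L" "length u' = wlen L u" "word u' = word u"
    using reduced_word[OF assms(1)] .
  have "wlen L (u @ t) = wlen L (u' @ t)"
    by (rule wlen_cong) (simp add: fun_eq_iff u'(3))
  also have "\<dots> \<le> length (u' @ t)"
    using u' assms by (intro wlen_le) auto
  finally show ?thesis using u' by simp
qed

text \<open>
  Deodhar's argument. Write $u = vx$ with $x$ in the dihedral group generated by $s_i$ and the last
  letter $s_j$ of a reduced word for $u$, with lengths adding up and $x$ as long as possible. Then
  neither $s_i$ nor $s_j$ shortens $v$, so $v\alpha_i$ and $v\alpha_j$ are nonnegative by induction, and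
  $x\alpha_i$ is a nonnegative combination of $\alpha_i$ and $\alpha_j$ by the rank two computation.
\<close>

lemma ascent_nonneg:
  assumes "u \<in> lists L" "i \<in> L" "wlen L u \<le> wlen L (u @ [i])"
  shows "nonneg (word u (\<alpha> i))"
  using assms
proof (induction "wlen L u" arbitrary: u i rule: less_induct)
  case less
  let ?n = "wlen L u"
  obtain t where t: "t \<in> lists L" "length t = ?n" "word t = word u"
    using reduced_word[OF less.prems(1)] .
  show ?case
  proof (cases t rule: rev_cases)
    case Nil
    with t have "word u (\<alpha> i) = \<alpha> i" by (metis word_Nil)
    then show ?thesis by (simp add: nonneg_root)
  next
    case (snoc t' j)
    with t have t': "t' \<in> lists L" "j \<in> L" "Suc (length t') = ?n" "word (t' @ [j]) = word u" by auto
    have "i \<noteq> j"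
    proof
      assume "i = j"
      then have "word (u @ [i]) = word t'"
        using t'(4) by (simp add: fun_eq_iff) (metis refl_refl)
      then have "wlen L (u @ [i]) \<le> length t'"
        using wlen_cong wlen_le t'(1) by metis
      with less.prems t' show False by simp
    qed
    \<comment> \<open>\<open>P p\<close>: the word can be factored, with lengths adding up, so that the right factor is alternating of length \<open>p\<close>.\<close>
    define P where "P p \<longleftrightarrow> (\<exists>v\<in>lists L. wlen L v + p = ?n \<and> word (v @ alt p i j) = word u)" for p
    have ij: "set y \<subseteq> {i, j} \<Longrightarrow> y \<in> lists L" for y
      using less.prems(2) t'(2) by auto
    have PI: "P p" if "v \<in> lists L" "wlen L v + p \<le> ?n" "word (v @ alt p i j) = word u" for v p
    proof -
      have "?n \<le> wlen L v + p"
        using wlen_append_le[OF that(1) ij[OF set_alt], of p] wlen_cong[OF that(3), of L] by simp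
      with that show ?thesis unfolding P_def by auto
    qed
    have "P 1" using t' wlen_le[OF t'(1)] by (intro PI[of t']) auto
    moreover have "\<forall>p. P p \<longrightarrow> p \<le> ?n" by (auto simp: P_def)
    ultimately obtain p where p: "P p" and pmax: "\<And>q. P q \<Longrightarrow> q \<le> p"
      using Greatest_le_nat[of P] GreatestI_nat[of P] by blast
    have "1 \<le> p" using pmax \<open>P 1\<close> by blast
    then obtain q where q: "p = Suc q" by (cases p) auto
    obtain v where v: "v \<in> lists L" "wlen L v + p = ?n" "word (v @ alt p i j) = word u"
      using p P_def by blast
    \<comment> \<open>A shortening letter either extends the alternating factor, against its maximality, or cancels its first letter, against reducedness.\<close>
    have asc: "wlen L v \<le> wlen L (v @ [k])" if k: "k \<in> {i, j}" for k
    proof (rule ccontr)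
      assume "\<not> ?thesis"
      then have less: "wlen L (v @ [k]) < wlen L v" by simp
      have vk: "v @ [k] \<in> lists L" using v(1) ij[of "[k]"] k by simp
      show False
      proof (cases "k = (if even p then j else i)")
        case True
        then have "alt (Suc p) i j = k # alt p i j" by (simp only: alt_Suc_left)
        then have "word ((v @ [k]) @ alt (Suc p) i j) = word u"
          using v(3) by (simp add: fun_eq_iff del: alt.simps)
        then have "P (Suc p)" using vk less v(2) by (intro PI[of "v @ [k]"]) auto
        with pmax show False by force
      next
        case False
        then have "k = (if even q then j else i)" using k q by auto
        then have "alt p i j = k # alt q i j" by (simp only: alt_Suc_left q)
        then have "word ((v @ [k]) @ alt q i j) = word u"
          using v(3) by (simp add: fun_eq_iff)
        then have "?n \<le> wlen L (v @ [k]) + q"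
          using wlen_append_le[OF vk ij[OF set_alt], of q] wlen_cong by (metis length_alt)
        with less v(2) q show False by simp
      qed
    qed
    have "wlen L v < ?n" using v(2) \<open>1 \<le> p\<close> by simp
    then have pos: "nonneg (word v (\<alpha> k))" if "k \<in> {i, j}" for k
      using less.hyps[of v k] v(1) asc[OF that] that less.prems(2) t'(2) by auto
    from alt_root[OF \<open>i \<noteq> j\<close>, of p] show ?thesis
    proof (elim disjE exE conjE)
      fix c d :: int
      assume c: "0 \<le> c" "0 \<le> d" and eq: "word (alt p i j) (\<alpha> i) = lin i j 0 (of_int c) (of_int d)"
      have "word u (\<alpha> i) = word v (lin i j 0 (of_int c) (of_int d))"
        using fun_cong[OF v(3), of "\<alpha> i"] eq by simp
      also have "\<dots> = (\<lambda>h. of_int c * word v (\<alpha> i) h + of_int d * word v (\<alpha> j) h)"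
        by (simp add: lin_def word_linear)
      finally show ?thesis using nonneg_comb[OF pos pos c] by simp
    next
      fix m assume m: "1 \<le> m" "m \<le> p" and br: "word (alt m i j) = word (alt m j i)"
      \<comment> \<open>The braid relation turns the alternating factor into one ending in \<open>i\<close>, so \<open>i\<close> would shorten the word.\<close>
      obtain y where y: "alt p i j = y @ alt m i j" using alt_split[OF m(2)] by blast
      obtain r where r: "m = Suc r" using m(1) by (cases m) auto
      have "word (u @ [i]) = word (v @ (y @ alt r i j))"
      proof
        fix \<mu>
        have "word (u @ [i]) \<mu> = word v (word y (word (alt m i j) (refl i \<mu>)))"
          using fun_cong[OF v(3), of "refl i \<mu>"] by (simp add: y)
        also have "\<dots> = word (v @ (y @ alt r i j)) \<mu>"
          unfolding br by (simp add: r)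
        finally show "word (u @ [i]) \<mu> = word (v @ (y @ alt r i j)) \<mu>" .
      qed
      moreover have "set (y @ alt r i j) \<subseteq> {i, j}"
        using set_alt[of p i j] set_alt[of r i j] y by auto
      ultimately have "wlen L (u @ [i]) \<le> wlen L v + length (y @ alt r i j)"
        using wlen_append_le[OF v(1) ij] wlen_cong by metis
      moreover have "length (y @ alt r i j) < p"
        using arg_cong[OF y, of length] r by simp
      ultimately show ?thesis using v(2) less.prems(3) by simp
    qed
  qed
qed

lemma descent_nonpos:
  assumes "u @ [i] \<in> lists L" "wlen L (u @ [i]) = length (u @ [i])"
  shows "nonneg (- word (u @ [i]) (\<alpha> i))"
proof -
  have "nonneg (word u (\<alpha> i))"
    using assms wlen_le[of u L] by (intro ascent_nonneg[of u L i]) auto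
  then show ?thesis by (simp add: refl_root_self word_minus)
qed

end

section \<open>Strings for an sl2-triple\<close>

lemma sum_fun_apply: "(\<Sum>k\<in>S. f k) x = (\<Sum>k\<in>S. f k x)"
  by (induction S rule: infinite_finite_induct) auto

text \<open>
  The usual primitive vector computation $E F^{t+1}u = (t+1)(m-t)F^tu$, stated for operators that form
  an $\mathfrak{sl}_2$-triple only up to what the computation uses, so that it also applies with the roles
  of \<open>E\<close> and \<open>F\<close> exchanged and \<open>H\<close> negated.
\<close>

lemma sl2_string:
  fixes sc :: "complex \<Rightarrow> 'v::ab_group_add \<Rightarrow> 'v"
  assumes vs: "vector_space sc"
    and F: "Vector_Spaces.linear sc sc F" and E: "Vector_Spaces.linear sc sc E"
    and comm: "\<And>x c. H x = sc c x \<Longrightarrow> H (F x) = sc (c - 2) (F x)"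
    and EF: "\<And>x. E (F x) - F (E x) = H x"
    and u: "u \<noteq> 0" "E u = 0" "H u = sc m u" "(F ^^ N) u = 0"
  obtains k where "m = of_nat k" "\<And>t. t \<le> k \<Longrightarrow> (F ^^ t) u \<noteq> 0"
proof -
  interpret vector_space sc by (rule vs)
  interpret F: Vector_Spaces.linear sc sc F by (rule F)
  interpret E: Vector_Spaces.linear sc sc E by (rule E)
  have H: "H ((F ^^ t) u) = sc (m - 2 * of_nat t) ((F ^^ t) u)" for t
  proof (induction t)
    case (Suc t)
    from comm[OF this] show ?case by (simp add: algebra_simps)
  qed (simp add: u)
  have EF': "E (F x) = F (E x) + H x" for x
    using EF[of x] by (metis diff_add_cancel add.commute)
  have EFt: "E ((F ^^ Suc t) u) = sc (of_nat (Suc t) * (m - of_nat t)) ((F ^^ t) u)" for t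
  proof (induction t)
    case 0
    show ?case using EF'[of u] by (simp add: u F.zero)
  next
    case (Suc t)
    have "E ((F ^^ Suc (Suc t)) u) = F (E ((F ^^ Suc t) u)) + H ((F ^^ Suc t) u)"
      using EF'[of "(F ^^ Suc t) u"] by simp
    also have "\<dots> = sc (of_nat (Suc t) * (m - of_nat t)) ((F ^^ Suc t) u)
        + sc (m - 2 * of_nat (Suc t)) ((F ^^ Suc t) u)"
      unfolding Suc.IH H F.scale by simp
    also have "\<dots> = sc (of_nat (Suc (Suc t)) * (m - of_nat (Suc t))) ((F ^^ Suc t) u)"
      unfolding scale_left_distrib[symmetric]
      by (rule arg_cong[where f = "\<lambda>c. sc c _"]) (simp add: algebra_simps)
    finally show ?case .
  qed
  define n where "n = (LEAST n. (F ^^ n) u = 0)"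
  have n: "(F ^^ n) u = 0" unfolding n_def by (rule LeastI) (rule u(4))
  have min: "(F ^^ t) u \<noteq> 0" if "t < n" for t
    using that unfolding n_def by (rule not_less_Least)
  have "n \<noteq> 0" using n u(1) by (intro notI) simp
  then obtain k where k: "n = Suc k" by (cases n) auto
  have "sc (of_nat (Suc k) * (m - of_nat k)) ((F ^^ k) u) = 0"
    using EFt[of k] n k by (simp add: E.zero del: of_nat_Suc)
  then have "m = of_nat k"
    using min[of k] k by (simp add: scale_eq_0_iff del: of_nat_Suc)
  with min k that show thesis by auto
qed

lemma last_nonzero_iterate:
  fixes T :: "'v::zero \<Rightarrow> 'v"
  assumes "w \<noteq> 0" "(T ^^ n) w = 0"
  obtains k where "(T ^^ k) w \<noteq> 0" "T ((T ^^ k) w) = 0"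
proof -
  define m where "m = (LEAST n. (T ^^ n) w = 0)"
  have m: "(T ^^ m) w = 0" unfolding m_def by (rule LeastI) (rule assms(2))
  with assms(1) have "m \<noteq> 0" by (intro notI) simp
  then obtain k where k: "m = Suc k" by (cases m) auto
  have "(T ^^ k) w \<noteq> 0"
    using k not_less_Least[of k "\<lambda>n. (T ^^ n) w = 0"] by (simp add: m_def)
  with m k that show thesis by simp
qed

section \<open>Highest weight modules\<close>

locale highest_weight_setting =
  fixes K :: "('i::finite, 'h::ab_group_add, 'g::ab_group_add) kac_moody_data"
    and V :: "('g, 'v::ab_group_add) lie_module"
    and \<Lambda> :: "'h \<Rightarrow> complex" and v :: 'v
  assumes km: "kac_moody_algebra K"
    and module: "g_module K V"
    and \<Lambda>: "\<Lambda> \<in> hdual K"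
    and v: "v \<noteq> 0" "v \<in> weight_space K V \<Lambda>"
    and n_plus_v: "x \<in> n_plus K \<Longrightarrow> act V x v = 0"
    and generates: "U_apply V UNIV {v} = UNIV"
begin

abbreviation "sc \<equiv> mscale V"
abbreviation "ac \<equiv> act V"
abbreviation "e \<equiv> chev_e K"
abbreviation "f \<equiv> chev_f K"
abbreviation "cartan \<equiv> cartan_incl K"
abbreviation "\<alpha> \<equiv> simple_root K"
abbreviation "coroot \<equiv> simple_coroot K"

lemma vs: "vector_space sc"
  and ac_linear: "Vector_Spaces.linear sc sc (ac x)"
  and ac_linear': "Vector_Spaces.linear (gscale K) sc (\<lambda>x. ac x w)"
  and ac_bracket: "ac (bracket K x y) w = ac x (ac y w) - ac y (ac x w)"
  using module by (simp_all add: g_module_def)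

lemma rel: "(s, t) \<in> km_relations K \<Longrightarrow>
    lie_eval (gscale K) (bracket K) (km_gen_eval K) s = lie_eval (gscale K) (bracket K) (km_gen_eval K) t"
  using km unfolding kac_moody_algebra_def lie_presented_def by (blast intro: lie_cong.rel)

lemma e_f: "bracket K (e i) (f j) = (if i = j then cartan (coroot i) else 0)"
  using rel[OF E_F_same[of i K]] rel[OF E_F_diff[of i j K]] by auto

lemma h_e: "bracket K (cartan h) (e i) = gscale K (\<alpha> i h) (e i)"
  using rel[OF H_E[of h i K]] by simp

lemma h_f: "bracket K (cartan h) (f i) = gscale K (- \<alpha> i h) (f i)"
  using rel[OF H_F[of h i K]] by simp

lemma realiz: "realization K" and gcm: "generalized_cartan_matrix (cartan_matrix K)"
  using km by (simp_all add: kac_moody_algebra_def)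

lemma roots_indep:
  assumes "\<And>h. (\<Sum>k\<in>UNIV. c k * \<alpha> k h) = 0"
  shows "c k = 0"
proof -
  interpret fn: module "\<lambda>c \<mu> (h::'h). (c::complex) * \<mu> h"
    by standard (auto simp: fun_eq_iff algebra_simps)
  have inj: "inj \<alpha>" and ind: "\<not> fn.dependent (range \<alpha>)"
    using realiz by (auto simp: realization_def)
  define g where "g = the_inv \<alpha>"
  have g: "g (\<alpha> k) = k" for k using inj by (simp add: g_def the_inv_f_f)
  have "(\<Sum>\<mu>\<in>range \<alpha>. (\<lambda>h. c (g \<mu>) * \<mu> h)) h = 0" for h
  proof -
    have "(\<Sum>\<mu>\<in>range \<alpha>. (\<lambda>h. c (g \<mu>) * \<mu> h)) = (\<Sum>k\<in>UNIV. (\<lambda>h. c k * \<alpha> k h))"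
      using inj by (simp add: sum.reindex g)
    then show ?thesis using assms[of h] by (simp add: sum_fun_apply)
  qed
  then have "(\<Sum>\<mu>\<in>range \<alpha>. (\<lambda>h. c (g \<mu>) * \<mu> h)) = 0" by (simp add: fun_eq_iff)
  then have "c (g (\<alpha> k)) = 0"
    using ind fn.dependent_finite[of "range \<alpha>"] by (meson finite_class.finite_UNIV finite_imageI rangeI)
  then show ?thesis using g by simp
qed

sublocale root_datum "cartan_matrix K" \<alpha> coroot
proof
  show "generalized_cartan_matrix (cartan_matrix K)" by (rule gcm)
  show "\<alpha> j (coroot i) = of_int (cartan_matrix K i j)" for i j
    using realiz by (simp add: realization_def)
  show "c k = 0" if "\<And>h. (\<Sum>k\<in>UNIV. c k * \<alpha> k h) = 0" for c k
    by (rule roots_indep) (rule that)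
qed

lemma hdual_lin: "\<mu> \<in> hdual K \<Longrightarrow> \<nu> \<in> hdual K \<Longrightarrow> (\<lambda>h. c * \<mu> h + d * \<nu> h) \<in> hdual K"
  unfolding hdual_def Vector_Spaces.linear_iff mem_Collect_eq
  by (elim conjE, intro conjI allI; (assumption | simp only: distrib_left mult.left_commute add.assoc add.left_commute))

lemma root_hdual: "\<alpha> i \<in> hdual K"
  using realiz by (auto simp: realization_def)

sublocale MV: vector_space sc by (rule vs)

lemma ac_add: "ac x (a + b) = ac x a + ac x b"
  and ac_scale: "ac x (sc c a) = sc c (ac x a)"
  using ac_linear[of x] by (simp_all add: Vector_Spaces.linear_iff)

lemma ac_zero [simp]: "ac x 0 = 0"
  using ac_scale[of x 0 0] by simp

lemma ac_add_left: "ac (x + y) w = ac x w + ac y w"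
  and ac_scale_left: "ac (gscale K c x) w = sc c (ac x w)"
  using ac_linear'[of w] by (simp_all add: Vector_Spaces.linear_iff)

lemma ac_zero_left [simp]: "ac 0 w = 0"
  using ac_add_left[of 0 0 w] by simp

abbreviation "wsp \<equiv> weight_space K V"

lemma wspI: "(\<And>h. ac (cartan h) w = sc (\<mu> h) w) \<Longrightarrow> w \<in> wsp \<mu>"
  and wspD: "w \<in> wsp \<mu> \<Longrightarrow> ac (cartan h) w = sc (\<mu> h) w"
  by (simp_all add: weight_space_def)

lemma subspace_wsp: "MV.subspace (wsp \<mu>)"
  by (rule MV.subspaceI) (auto simp: weight_space_def ac_add ac_scale MV.scale_right_distrib mult.commute)

lemma weight_unique: "w \<noteq> 0 \<Longrightarrow> w \<in> wsp \<mu> \<Longrightarrow> w \<in> wsp \<nu> \<Longrightarrow> \<mu> = \<nu>"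
  by (rule ext) (metis MV.scale_right_imp_eq wspD)

lemma ac_commute: "ac x (ac y w) = ac (bracket K x y) w + ac y (ac x w)"
  by (simp add: ac_bracket)

lemma f_weight: "w \<in> wsp \<mu> \<Longrightarrow> ac (f i) w \<in> wsp (\<mu> - \<alpha> i)"
  by (rule wspI)
     (simp add: ac_commute[of "cartan _" "f i"] h_f ac_scale_left ac_scale wspD MV.scale_left_diff_distrib)

lemma e_weight: "w \<in> wsp \<mu> \<Longrightarrow> ac (e i) w \<in> wsp (\<mu> + \<alpha> i)"
  by (rule wspI)
     (simp add: ac_commute[of "cartan _" "e i"] h_e ac_scale_left ac_scale wspD MV.scale_left_distrib add.commute)

definition f_mon :: "'i list \<Rightarrow> 'v" where
  "f_mon u = foldr (\<lambda>i. ac (f i)) u v"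

definition mon_wt :: "'i list \<Rightarrow> 'h \<Rightarrow> complex" where
  "mon_wt u = \<Lambda> - root_comb (\<lambda>k. int (count_list u k))"

lemma f_mon_simps [simp]: "f_mon [] = v" "f_mon (i # u) = ac (f i) (f_mon u)"
  by (simp_all add: f_mon_def)

lemma f_mon_foldr: "f_mon u = foldr ac (map f u) v"
  by (induction u) auto

lemma f_mon_ConsD: "f_mon (i # u) \<noteq> 0 \<Longrightarrow> f_mon u \<noteq> 0"
  by auto

lemma mon_wt_Nil [simp]: "mon_wt [] = \<Lambda>"
  by (simp add: mon_wt_def)

lemma mon_wt_Cons: "mon_wt (i # u) = mon_wt u - \<alpha> i"
proof -
  have "(\<lambda>k. int (count_list (i # u) k)) = (\<lambda>k. int (count_list u k) + (if k = i then 1 else 0))"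
    by auto
  then show ?thesis
    by (simp add: mon_wt_def root_comb_add root_comb_single fun_eq_iff)
qed

lemma mon_wt_eqD: "mon_wt u = mon_wt t \<Longrightarrow> count_list u = count_list t"
proof -
  assume "mon_wt u = mon_wt t"
  then have "root_comb (\<lambda>k. int (count_list u k)) = root_comb (\<lambda>k. int (count_list t k))"
    by (simp add: mon_wt_def fun_eq_iff)
  from root_comb_inj[OF this] show ?thesis by (simp add: fun_eq_iff)
qed

lemma mon_wt_eq_set: "mon_wt u = mon_wt t \<Longrightarrow> set u = set t"
proof -
  assume "mon_wt u = mon_wt t"
  from mon_wt_eqD[OF this] have "k \<in> set u \<longleftrightarrow> k \<in> set t" for k
    using count_list_0_iff[of u k] count_list_0_iff[of t k] by simp
  then show ?thesis by blast
qed

lemma mon_wt_hdual: "mon_wt u \<in> hdual K"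
proof (induction u)
  case (Cons i u)
  from hdual_lin[OF this root_hdual, of 1 "-1" i] show ?case
    by (simp add: mon_wt_Cons fun_diff_def)
qed (simp add: \<Lambda>)

lemma f_mon_weight: "f_mon u \<in> wsp (mon_wt u)"
proof (induction u)
  case (Cons i u)
  show ?case unfolding f_mon_simps mon_wt_Cons by (rule f_weight) (rule Cons.IH)
qed (simp add: v)

section \<open>Spans of monomials in the lowering operators\<close>

definition mons :: "'i set \<Rightarrow> 'v set" where
  "mons J = f_mon ` lists J"

definition mon_span :: "'i set \<Rightarrow> 'v set" where
  "mon_span J = MV.span (mons J)"

lemma subspace_mon_span: "MV.subspace (mon_span J)"
  by (simp add: mon_span_def)

lemma f_mon_mon_span: "u \<in> lists J \<Longrightarrow> f_mon u \<in> mon_span J"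
  by (simp add: mon_span_def mons_def MV.span_base)

lemma mon_span_stableI:
  assumes "\<And>u. u \<in> lists J \<Longrightarrow> ac x (f_mon u) \<in> mon_span J" and "w \<in> mon_span J"
  shows "ac x w \<in> mon_span J"
  using assms(2) unfolding mon_span_def
proof (induction rule: MV.span_induct)
  case base
  show ?case
    unfolding mon_span_def[symmetric]
    using subspace_mon_span[of J]
    by (auto intro!: MV.subspaceI simp: ac_add ac_scale MV.subspace_0 MV.subspace_add MV.subspace_scale)
next
  case (step w)
  then show ?case using assms(1) by (auto simp: mons_def mon_span_def)
qed

lemma f_stable: "j \<in> J \<Longrightarrow> w \<in> mon_span J \<Longrightarrow> ac (f j) w \<in> mon_span J"
  by (rule mon_span_stableI) (metis Cons_in_lists_iff f_mon_mon_span f_mon_simps(2))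

lemma h_stable: "w \<in> mon_span J \<Longrightarrow> ac (cartan h) w \<in> mon_span J"
  by (rule mon_span_stableI) (simp_all add: wspD[OF f_mon_weight] f_mon_mon_span MV.subspace_scale[OF subspace_mon_span])

text \<open>
  Moving $e_i$ to the right through a monomial leaves terms with one $f_i$ replaced by a coroot, which
  acts as a scalar on what follows.
\<close>

lemma e_stable: "w \<in> mon_span J \<Longrightarrow> ac (e i) w \<in> mon_span J"
proof (rule mon_span_stableI)
  fix u assume "u \<in> lists J"
  then show "ac (e i) (f_mon u) \<in> mon_span J"
  proof (induction u)
    case Nil
    have "e i \<in> n_plus K" unfolding n_plus_def by (rule hull_inc) simp
    then show ?case by (simp add: n_plus_v MV.subspace_0[OF subspace_mon_span])
  next
    case (Cons j u)
    have "ac (bracket K (e i) (f j)) (f_mon u) \<in> mon_span J"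
      using Cons h_stable by (simp add: e_f f_mon_mon_span MV.subspace_0[OF subspace_mon_span])
    moreover have "ac (f j) (ac (e i) (f_mon u)) \<in> mon_span J"
      using Cons by (intro f_stable) auto
    ultimately show ?case
      by (simp add: ac_commute[of "e i" "f j"] MV.subspace_add[OF subspace_mon_span])
  qed
qed

lemma stabilizer_subalgebra: "lie_subalgebra K {x. \<forall>w\<in>mon_span J. ac x w \<in> mon_span J}"
proof -
  interpret L: complex_lie_algebra "gscale K" "bracket K"
    using km by (simp add: kac_moody_algebra_def)
  have "L.subspace {x. \<forall>w\<in>mon_span J. ac x w \<in> mon_span J}"
    using subspace_mon_span[of J]
    by (intro L.subspaceI)
       (auto simp: ac_add_left ac_scale_left MV.subspace_0 MV.subspace_add MV.subspace_scale)
  then show ?thesis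
    using subspace_mon_span[of J] by (auto simp: lie_subalgebra_def ac_bracket MV.subspace_diff)
qed

lemma levi_stable: "x \<in> levi K J \<Longrightarrow> w \<in> mon_span J \<Longrightarrow> ac x w \<in> mon_span J"
proof -
  have "levi K J \<subseteq> {x. \<forall>w\<in>mon_span J. ac x w \<in> mon_span J}"
    unfolding levi_def
    by (rule hull_minimal) (auto simp: stabilizer_subalgebra h_stable e_stable f_stable)
  then show "x \<in> levi K J \<Longrightarrow> w \<in> mon_span J \<Longrightarrow> ac x w \<in> mon_span J" by blast
qed

text \<open>
  The algebra is presented by generators, so every element is the value of a Lie term in them.
\<close>

lemma all_stable: "w \<in> mon_span UNIV \<Longrightarrow> ac x w \<in> mon_span UNIV"
proof -
  have S: "lie_subalgebra K {x. \<forall>w\<in>mon_span UNIV. ac x w \<in> mon_span UNIV}" (is "lie_subalgebra K ?S")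
    by (rule stabilizer_subalgebra)
  interpret L: complex_lie_algebra "gscale K" "bracket K"
    using km by (simp add: kac_moody_algebra_def)
  have sub: "L.subspace ?S" and br: "\<And>x y. x \<in> ?S \<Longrightarrow> y \<in> ?S \<Longrightarrow> bracket K x y \<in> ?S"
    using S unfolding lie_subalgebra_def by blast+
  have "lie_eval (gscale K) (bracket K) (km_gen_eval K) t \<in> ?S" for t
  proof (induction t)
    case (Gen x)
    then show ?case by (cases x) (auto simp: h_stable e_stable f_stable)
  next
    case Zero
    show ?case using L.subspace_0[OF sub] by simp
  next
    case (Plus s t)
    then show ?case using L.subspace_add[OF sub] by simp
  next
    case (Scale c t)
    then show ?case using L.subspace_scale[OF sub] by simp
  next
    case (Brk s t)
    then show ?case using br by simp
  qed
  moreover have "x \<in> range (lie_eval (gscale K) (bracket K) (km_gen_eval K))"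
    using km by (simp add: kac_moody_algebra_def lie_presented_def)
  ultimately show "w \<in> mon_span UNIV \<Longrightarrow> ac x w \<in> mon_span UNIV" by blast
qed

lemma foldr_stable:
  "(\<And>x w. x \<in> set xs \<Longrightarrow> w \<in> mon_span J \<Longrightarrow> ac x w \<in> mon_span J) \<Longrightarrow> w \<in> mon_span J \<Longrightarrow> foldr ac xs w \<in> mon_span J"
  by (induction xs) auto

lemma mon_span_UNIV: "mon_span UNIV = UNIV"
proof -
  have "U_apply V UNIV {v} \<subseteq> mon_span UNIV"
    unfolding U_apply_def
    using f_mon_mon_span[of "[]" UNIV] all_stable
    by (intro MV.span_minimal subspace_mon_span) (auto intro!: foldr_stable)
  then show ?thesis using generates by blast
qed

section \<open>Weights of the spans of monomials\<close>

text \<open>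
  Simultaneous eigenspaces are independent: the operator $h - \rho(h)$ removes the component of weight
  $\rho$ and multiplies another one by a factor that is nonzero for a suitable $h$.
\<close>

lemma weight_sum_zero:
  assumes "finite F" "\<And>\<nu>. \<nu> \<in> F \<Longrightarrow> x \<nu> \<in> wsp \<nu>" "sum x F = 0" "\<nu> \<in> F"
  shows "x \<nu> = 0"
  using assms
proof (induction F arbitrary: x \<nu> rule: finite_induct)
  case (insert \<rho> F)
  have ac_sum: "ac y (sum x F) = (\<Sum>\<nu>\<in>F. ac y (x \<nu>))" for y
    using insert.hyps(1) by (induction F rule: finite_induct) (simp_all add: ac_add)
  have other: "x \<tau> = 0" if "\<tau> \<in> F" for \<tau>
  proof -
    from that insert.hyps have "\<tau> \<noteq> \<rho>" by auto
    then obtain h where h: "\<tau> h \<noteq> \<rho> h" by (auto simp: fun_eq_iff)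
    have "(\<Sum>\<nu>\<in>F. sc (\<nu> h) (x \<nu>)) = ac (cartan h) (sum x F)"
      unfolding ac_sum by (rule sum.cong) (simp_all add: wspD[OF insert.prems(1)])
    then have "(\<Sum>\<nu>\<in>F. sc (\<nu> h - \<rho> h) (x \<nu>)) = ac (cartan h) (sum x F) - sc (\<rho> h) (sum x F)"
      by (simp add: MV.scale_sum_right MV.scale_left_diff_distrib sum_subtractf)
    also have "\<dots> = 0"
    proof -
      have "x \<rho> + sum x F = 0"
        using insert.prems(2) insert.hyps by simp
      then have "sum x F = - x \<rho>" by (metis add_eq_0_iff)
      then have "sum x F \<in> wsp \<rho>"
        using MV.subspace_neg[OF subspace_wsp insert.prems(1)[of \<rho>]] by simp
      then show ?thesis by (simp add: wspD)
    qed
    finally have "sc (\<tau> h - \<rho> h) (x \<tau>) = 0"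
      using insert.prems(1) that
      by (intro insert.IH[of "\<lambda>\<nu>. sc (\<nu> h - \<rho> h) (x \<nu>)"])
         (auto intro!: MV.subspace_scale[OF subspace_wsp])
    with h show ?thesis by simp
  qed
  then have "sum x F = 0" by (rule sum.neutral[OF ballI])
  with insert.prems(2) insert.hyps have "x \<rho> = 0" by simp
  with other insert.prems(3) show ?case by blast
qed simp

lemma span_weight_component:
  assumes M: "\<And>m. m \<in> M \<Longrightarrow> \<exists>\<nu>. m \<in> wsp \<nu>"
    and w: "w \<in> MV.span M" "w \<in> wsp \<mu>"
  shows "w \<in> MV.span (M \<inter> wsp \<mu>)"
proof -
  have "\<exists>F x. finite F \<and> (\<forall>\<nu>. x \<nu> \<in> MV.span (M \<inter> wsp \<nu>)) \<and> (\<forall>\<nu>. \<nu> \<notin> F \<longrightarrow> x \<nu> = 0) \<and> w = sum x F"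
    using w(1)
  proof (induction rule: MV.span_induct_alt)
    case base
    show ?case by (intro exI[of _ "{}"] exI[of _ "\<lambda>_. 0"]) (simp add: MV.span_zero)
  next
    case (step c m y)
    then obtain F x where F: "finite F" "\<forall>\<nu>. x \<nu> \<in> MV.span (M \<inter> wsp \<nu>)"
      "\<forall>\<nu>. \<nu> \<notin> F \<longrightarrow> x \<nu> = 0" "y = sum x F" by blast
    obtain \<rho> where \<rho>: "m \<in> wsp \<rho>" using M[OF step(1)] by blast
    define x' where "x' \<nu> = (if \<nu> = \<rho> then sc c m else 0) + x \<nu>" for \<nu>
    have "sum x (insert \<rho> F) = sum x F"
      using F by (intro sum.mono_neutral_right) auto
    then have "sum x' (insert \<rho> F) = sc c m + y"
      using F by (simp add: x'_def sum.distrib)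
    moreover have "x' \<nu> \<in> MV.span (M \<inter> wsp \<nu>)" for \<nu>
      using F(2) step(1) \<rho> unfolding x'_def
      by (intro MV.span_add) (auto intro: MV.span_scale MV.span_base MV.span_zero)
    ultimately show ?case
      using F by (intro exI[of _ "insert \<rho> F"] exI[of _ x']) (auto simp: x'_def)
  qed
  then obtain F x where F: "finite F" "\<And>\<nu>. x \<nu> \<in> MV.span (M \<inter> wsp \<nu>)"
    "\<And>\<nu>. \<nu> \<notin> F \<Longrightarrow> x \<nu> = 0" "w = sum x F" by blast
  define y where "y \<nu> = x \<nu> - (if \<nu> = \<mu> then w else 0)" for \<nu>
  have "sum x (insert \<mu> F) = sum x F"
    using F by (intro sum.mono_neutral_right) auto
  then have "sum y (insert \<mu> F) = 0"
    using F by (simp add: y_def sum_subtractf)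
  moreover have "y \<nu> \<in> wsp \<nu>" for \<nu>
  proof -
    have "MV.span (M \<inter> wsp \<nu>) \<subseteq> wsp \<nu>"
      by (rule MV.span_minimal) (auto simp: subspace_wsp)
    with F(2) w(2) show ?thesis
      unfolding y_def by (intro MV.subspace_diff[OF subspace_wsp]) (auto intro: MV.subspace_0[OF subspace_wsp])
  qed
  ultimately have "y \<mu> = 0"
    using F(1) by (intro weight_sum_zero[of "insert \<mu> F" y \<mu>]) auto
  with F(2)[of \<mu>] show ?thesis by (simp add: y_def)
qed

lemma mon_span_weight: "w \<in> mon_span J \<Longrightarrow> w \<in> wsp \<mu> \<Longrightarrow> w \<in> MV.span (mons J \<inter> wsp \<mu>)"
  unfolding mon_span_def by (rule span_weight_component) (auto simp: mons_def intro: f_mon_weight)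

lemma highest_weight_space: "wsp \<Lambda> = MV.span {v}"
proof
  have "mons UNIV \<inter> wsp \<Lambda> \<subseteq> MV.span {v}"
  proof
    fix m assume m: "m \<in> mons UNIV \<inter> wsp \<Lambda>"
    then obtain u where u: "m = f_mon u" by (auto simp: mons_def)
    show "m \<in> MV.span {v}"
    proof (cases "m = 0")
      case False
      then have "mon_wt u = mon_wt []" using m u f_mon_weight weight_unique by (metis IntD2 mon_wt_Nil)
      then have "u = []" using mon_wt_eq_set[of u "[]"] by simp
      then show ?thesis by (simp add: u MV.span_base)
    qed (simp add: MV.span_zero)
  qed
  then have "MV.span (mons UNIV \<inter> wsp \<Lambda>) \<subseteq> MV.span {v}"
    by (intro MV.span_minimal) auto
  then show "wsp \<Lambda> \<subseteq> MV.span {v}" using mon_span_weight mon_span_UNIV by blast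
  show "MV.span {v} \<subseteq> wsp \<Lambda>"
    using v by (intro MV.span_minimal subspace_wsp) auto
qed

lemma U_levi: "U_apply V (levi K J) (wsp \<Lambda>) = mon_span J"
proof
  have "wsp \<Lambda> \<subseteq> mon_span J"
    unfolding highest_weight_space
    using f_mon_mon_span[of "[]" J] by (intro MV.span_minimal subspace_mon_span) auto
  then show "U_apply V (levi K J) (wsp \<Lambda>) \<subseteq> mon_span J"
    unfolding U_apply_def
    by (intro MV.span_minimal subspace_mon_span) (auto intro!: foldr_stable intro: levi_stable)
  have "f ` J \<subseteq> levi K J"
    unfolding levi_def by (rule subset_trans[OF _ hull_subset]) auto
  then have "f_mon u \<in> {foldr ac xs w |xs w. set xs \<subseteq> levi K J \<and> w \<in> wsp \<Lambda>}" if "u \<in> lists J" for u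
    using that v(2) \<open>f ` J \<subseteq> levi K J\<close>
    by (intro CollectI exI[of _ "map f u"] exI[of _ v]) (auto simp: f_mon_foldr)
  then show "mon_span J \<subseteq> U_apply V (levi K J) (wsp \<Lambda>)"
    unfolding U_apply_def mon_span_def mons_def by (intro MV.span_mono) auto
qed

lemma wt_mon_span: "wt K V (mon_span J) = {mon_wt u |u. u \<in> lists J \<and> f_mon u \<noteq> 0}"
proof (intro equalityI subsetI)
  fix \<mu> assume "\<mu> \<in> wt K V (mon_span J)"
  then obtain w where w: "w \<in> mon_span J" "w \<noteq> 0" "w \<in> wsp \<mu>" by (auto simp: wt_def)
  have "\<not> mons J \<inter> wsp \<mu> \<subseteq> {0}"
  proof
    assume "mons J \<inter> wsp \<mu> \<subseteq> {0}"
    then have "MV.span (mons J \<inter> wsp \<mu>) \<subseteq> {0}" by (rule MV.span_minimal) simp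
    with mon_span_weight[OF w(1,3)] w(2) show False by auto
  qed
  then obtain u where "u \<in> lists J" "f_mon u \<noteq> 0" "f_mon u \<in> wsp \<mu>" by (auto simp: mons_def)
  then show "\<mu> \<in> {mon_wt u |u. u \<in> lists J \<and> f_mon u \<noteq> 0}" using f_mon_weight weight_unique by blast
next
  fix \<mu> assume "\<mu> \<in> {mon_wt u |u. u \<in> lists J \<and> f_mon u \<noteq> 0}"
  then show "\<mu> \<in> wt K V (mon_span J)" by (auto simp: wt_def mon_wt_hdual intro: f_mon_mon_span f_mon_weight)
qed

lemma wt_J_eq: "wt_J K V \<Lambda> J = {mon_wt u |u. u \<in> lists J \<and> f_mon u \<noteq> 0}"
  by (simp add: wt_J_def U_levi wt_mon_span)

lemma wt_UNIV_eq: "wt K V UNIV = {mon_wt u |u. f_mon u \<noteq> 0}"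
  using wt_mon_span[of UNIV] by (simp add: mon_span_UNIV)

abbreviation "L \<equiv> integrable_nodes K V"
abbreviation "wtJ J \<equiv> wt_J K V \<Lambda> J"

section \<open>Invariance of the weights under integrable reflections\<close>

lemma f_pow_weight: "w \<in> wsp \<mu> \<Longrightarrow> (ac (f i) ^^ t) w \<in> wsp (\<lambda>h. \<mu> h - of_nat t * \<alpha> i h)"
proof (induction t)
  case (Suc t)
  have "(\<lambda>h. \<mu> h - of_nat (Suc t) * \<alpha> i h) = (\<lambda>h. \<mu> h - of_nat t * \<alpha> i h) - \<alpha> i"
    by (simp add: fun_eq_iff algebra_simps)
  then show ?case using f_weight[OF Suc.IH[OF Suc.prems], of i] by (simp only: funpow.simps(2) comp_apply)
qed simp

lemma e_pow_weight: "w \<in> wsp \<mu> \<Longrightarrow> (ac (e i) ^^ t) w \<in> wsp (\<lambda>h. \<mu> h + of_nat t * \<alpha> i h)"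
proof (induction t)
  case (Suc t)
  have "(\<lambda>h. \<mu> h + of_nat (Suc t) * \<alpha> i h) = (\<lambda>h. \<mu> h + of_nat t * \<alpha> i h) + \<alpha> i"
    by (simp add: fun_eq_iff algebra_simps)
  then show ?case using e_weight[OF Suc.IH[OF Suc.prems], of i] by (simp only: funpow.simps(2) comp_apply)
qed simp

lemma mon_wt_add_eqD:
  assumes "mon_wt u + root_comb c = mon_wt t"
  shows "int (count_list t k) = int (count_list u k) - c k"
proof -
  have "root_comb (\<lambda>k. int (count_list u k) - c k) = root_comb (\<lambda>k. int (count_list t k))"
    unfolding root_comb_diff
  proof
    fix h
    from fun_cong[OF assms, of h]
    show "(root_comb (\<lambda>k. int (count_list u k)) - root_comb c) h = root_comb (\<lambda>k. int (count_list t k)) h"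
      by (simp add: mon_wt_def algebra_simps)
  qed
  from root_comb_inj[OF this] show ?thesis by (metis (mono_tags, lifting))
qed

lemma wt_UNIV_I: "w \<noteq> 0 \<Longrightarrow> w \<in> wsp \<mu> \<Longrightarrow> \<mu> \<in> hdual K \<Longrightarrow> \<mu> \<in> wt K V UNIV"
  by (auto simp: wt_def)

text \<open>
  Weights lie below $\lambda$, and the coefficient of $\alpha_i$ in $\lambda - \mu$ bounds how often $e_i$ can
  be applied.
\<close>

lemma e_nilpotent:
  assumes "w \<in> wsp \<mu>" "\<mu> \<in> hdual K"
  shows "\<exists>n. (ac (e i) ^^ n) w = 0"
proof (cases "w = 0")
  case True
  then show ?thesis by (intro exI[of _ 0]) simp
next
  case False
  then obtain u where u: "\<mu> = mon_wt u"
    using wt_UNIV_I[OF False assms] by (auto simp: wt_UNIV_eq)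
  define n where "n = Suc (count_list u i)"
  have "(ac (e i) ^^ n) w = 0"
  proof (rule ccontr)
    assume nz: "(ac (e i) ^^ n) w \<noteq> 0"
    have "(\<lambda>h. \<mu> h + of_nat n * \<alpha> i h) \<in> wt K V UNIV"
      using hdual_lin[OF assms(2) root_hdual, of 1 "of_nat n" i]
      by (intro wt_UNIV_I[OF nz e_pow_weight[OF assms(1)]]) simp
    then obtain t where "(\<lambda>h. \<mu> h + of_nat n * \<alpha> i h) = mon_wt t" by (auto simp: wt_UNIV_eq)
    then have "mon_wt u + root_comb (\<lambda>k. if k = i then int n else 0) = mon_wt t"
      by (simp add: root_comb_single u plus_fun_def)
    from mon_wt_add_eqD[OF this, of i] show False by (simp add: n_def)
  qed
  then show ?thesis ..
qed

lemma coroot_f: "ac (cartan (coroot i)) x = sc c x \<Longrightarrow> ac (cartan (coroot i)) (ac (f i) x) = sc (c - 2) (ac (f i) x)"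
  by (simp add: ac_commute[of "cartan _" "f i"] h_f ac_scale_left ac_scale pairing MV.scale_left_diff_distrib)

lemma coroot_e: "ac (cartan (coroot i)) x = sc c x \<Longrightarrow> ac (cartan (coroot i)) (ac (e i) x) = sc (c + 2) (ac (e i) x)"
  by (simp add: ac_commute[of "cartan _" "e i"] h_e ac_scale_left ac_scale pairing MV.scale_left_distrib add.commute)

lemma refl_hdual: "\<mu> \<in> hdual K \<Longrightarrow> refl i \<mu> \<in> hdual K"
  using hdual_lin[OF _ root_hdual, of \<mu> 1 "- \<mu> (coroot i)" i] by (simp add: refl_def)

lemma word_hdual: "\<mu> \<in> hdual K \<Longrightarrow> word u \<mu> \<in> hdual K"
  by (induction u) (auto intro: refl_hdual)

text \<open>
  Starting from a vector of weight $\mu$, go up the $\alpha_i$-string with $e_i$ to a vector \<open>x\<close> killed by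
  $e_i$, and down with $f_i$ to a vector \<open>y\<close> killed by $f_i$. Each of them generates an unbroken string of
  weights symmetric under $s_i$; at least one of the two strings is long enough to contain $s_i\mu$.
\<close>

lemma refl_weight:
  assumes i: "i \<in> L" and \<mu>: "\<mu> \<in> wt K V UNIV"
  shows "refl i \<mu> \<in> wt K V UNIV"
proof -
  obtain w where w: "w \<noteq> 0" "w \<in> wsp \<mu>" and \<mu>h: "\<mu> \<in> hdual K" using \<mu> by (auto simp: wt_def)
  let ?n = "\<mu> (coroot i)"
  have f_nil: "\<exists>n. (ac (f i) ^^ n) x = 0" for x using i by (simp add: integrable_nodes_def)
  have target: "refl i \<mu> \<in> wt K V UNIV" if "x \<noteq> 0" "x \<in> wsp \<nu>" "\<nu> = refl i \<mu>" for x \<nu>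
    using that wt_UNIV_I refl_hdual[OF \<mu>h] by blast
  have ef: "ac (e i) (ac (f i) x) - ac (f i) (ac (e i) x) = ac (cartan (coroot i)) x" for x
    using ac_bracket[of "e i" "f i" x] by (simp add: e_f)
  obtain k where k: "(ac (e i) ^^ k) w \<noteq> 0" "ac (e i) ((ac (e i) ^^ k) w) = 0"
    using e_nilpotent[OF w(2) \<mu>h, of i] last_nonzero_iterate[OF w(1)] by metis
  define x where "x = (ac (e i) ^^ k) w"
  have xw: "x \<in> wsp (\<lambda>h. \<mu> h + of_nat k * \<alpha> i h)"
    unfolding x_def by (rule e_pow_weight) (rule w(2))
  obtain N where N: "(ac (f i) ^^ N) x = 0" using f_nil by blast
  obtain k1 where k1: "?n + 2 * of_nat k = of_nat k1" "\<And>t. t \<le> k1 \<Longrightarrow> (ac (f i) ^^ t) x \<noteq> 0"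
  proof (rule sl2_string[OF vs ac_linear[of "f i"] ac_linear[of "e i"], of "ac (cartan (coroot i))" x "?n + 2 * of_nat k" N])
    show "ac (cartan (coroot i)) x = sc (?n + 2 * of_nat k) x"
      using wspD[OF xw, of "coroot i"] by (simp add: pairing mult.commute)
  qed (use k N ef coroot_f in \<open>auto simp: x_def\<close>)
  obtain l where l: "(ac (f i) ^^ l) w \<noteq> 0" "ac (f i) ((ac (f i) ^^ l) w) = 0"
    using f_nil[of w] last_nonzero_iterate[OF w(1)] by metis
  define y where "y = (ac (f i) ^^ l) w"
  have yw: "y \<in> wsp (\<lambda>h. \<mu> h - of_nat l * \<alpha> i h)"
    unfolding y_def by (rule f_pow_weight) (rule w(2))
  have "(\<lambda>h. \<mu> h - of_nat l * \<alpha> i h) \<in> hdual K"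
    using hdual_lin[OF \<mu>h root_hdual, of 1 "- of_nat l" i] by simp
  then obtain M where M: "(ac (e i) ^^ M) y = 0" using e_nilpotent[OF yw] by blast
  obtain k2 where k2: "2 * of_nat l - ?n = of_nat k2" "\<And>t. t \<le> k2 \<Longrightarrow> (ac (e i) ^^ t) y \<noteq> 0"
  proof (rule sl2_string[OF vs ac_linear[of "e i"] ac_linear[of "f i"],
        of "\<lambda>x. - ac (cartan (coroot i)) x" y "2 * of_nat l - ?n" M])
    show "- ac (cartan (coroot i)) y = sc (2 * of_nat l - ?n) y"
      using wspD[OF yw, of "coroot i"]
      by (simp add: pairing mult.commute flip: MV.scale_minus_left)
    show "- ac (cartan (coroot i)) (ac (e i) x) = sc (c - 2) (ac (e i) x)"
      if "- ac (cartan (coroot i)) x = sc c x" for x c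
    proof -
      have "ac (cartan (coroot i)) x = sc (- c) x"
        unfolding MV.scale_minus_left that[symmetric] by simp
      from coroot_e[OF this] show ?thesis
        by (simp flip: MV.scale_minus_left)
    qed
    show "ac (f i) (ac (e i) x) - ac (e i) (ac (f i) x) = - ac (cartan (coroot i)) x" for x
      unfolding ef[symmetric] by simp
  qed (use l M in \<open>auto simp: y_def\<close>)
  show ?thesis
  proof (cases "k \<le> k1")
    case True
    have n1: "?n = of_nat k1 - 2 * of_nat k" using k1(1)[symmetric] by simp
    have eq: "(\<lambda>h. (\<mu> h + of_nat k * \<alpha> i h) - of_nat (k1 - k) * \<alpha> i h) = refl i \<mu>"
      using True unfolding refl_def n1 by (simp add: fun_eq_iff algebra_simps)
    show ?thesis by (rule target[OF k1(2) f_pow_weight[OF xw] eq]) simp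
  next
    case False
    \<comment> \<open>The two strings have total length $k_1 + k_2 = 2k + 2l$, so if the first one fails to come back to $\mu$, the second one reaches it.\<close>
    have "of_nat (k1 + k2) = (of_nat (2 * k + 2 * l) :: complex)"
      using k1(1)[symmetric] k2(1)[symmetric] by simp
    then have "k1 + k2 = 2 * k + 2 * l" by (simp only: of_nat_eq_iff)
    with False have "l \<le> k2" by simp
    have n2: "?n = 2 * of_nat l - of_nat k2" using k2(1)[symmetric] by simp
    from \<open>l \<le> k2\<close> have eq: "(\<lambda>h. (\<mu> h - of_nat l * \<alpha> i h) + of_nat (k2 - l) * \<alpha> i h) = refl i \<mu>"
      unfolding refl_def n2 by (simp add: fun_eq_iff algebra_simps)
    show ?thesis by (rule target[OF k2(2) e_pow_weight[OF yw] eq]) simp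
  qed
qed

lemma word_weight: "u \<in> lists L \<Longrightarrow> \<mu> \<in> wt K V UNIV \<Longrightarrow> word u \<mu> \<in> wt K V UNIV"
  by (induction u) (auto intro: refl_weight)

section \<open>The interval of subsets with the same weights\<close>

text \<open>
  The least element $J_{\min}$ of the interval belonging to \<open>J\<close>: the nodes that weights in
  $\mathrm{wt}_J V$ use.
\<close>

definition supp :: "'i set \<Rightarrow> 'i set" where
  "supp J = \<Union> {set u |u. u \<in> lists J \<and> f_mon u \<noteq> 0}"

definition Jmax :: "'i set \<Rightarrow> 'i set" where
  "Jmax J = {t. wtJ (insert t (supp J)) = wtJ J}"

lemma supp_subset: "supp J \<subseteq> J"
  by (auto simp: supp_def)

lemma set_supp: "u \<in> lists J \<Longrightarrow> f_mon u \<noteq> 0 \<Longrightarrow> set u \<subseteq> supp J"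
  by (auto simp: supp_def)

text \<open>
  Membership of a monomial weight is a condition on its indices, because the weight determines their
  set.
\<close>

lemma mon_wt_wtJ: "f_mon u \<noteq> 0 \<Longrightarrow> mon_wt u \<in> wtJ J \<longleftrightarrow> u \<in> lists J"
proof
  assume "mon_wt u \<in> wtJ J"
  then obtain t where "t \<in> lists J" "mon_wt u = mon_wt t" by (auto simp: wt_J_eq)
  then show "u \<in> lists J" using mon_wt_eq_set by auto
qed (auto simp: wt_J_eq)

lemma wtJ_subset_iff: "wtJ J \<subseteq> wtJ J' \<longleftrightarrow> supp J \<subseteq> J'"
proof
  assume sub: "wtJ J \<subseteq> wtJ J'"
  show "supp J \<subseteq> J'"
  proof
    fix k assume "k \<in> supp J"
    then obtain u where u: "k \<in> set u" "u \<in> lists J" "f_mon u \<noteq> 0" by (auto simp: supp_def)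
    then have "mon_wt u \<in> wtJ J'" using sub mon_wt_wtJ[OF u(3)] by blast
    with u mon_wt_wtJ[OF u(3)] show "k \<in> J'" by auto
  qed
next
  assume "supp J \<subseteq> J'"
  show "wtJ J \<subseteq> wtJ J'"
  proof
    fix \<mu> assume "\<mu> \<in> wtJ J"
    then obtain u where u: "u \<in> lists J" "f_mon u \<noteq> 0" "\<mu> = mon_wt u" by (auto simp: wt_J_eq)
    then have "set u \<subseteq> J'" using set_supp \<open>supp J \<subseteq> J'\<close> by blast
    then show "\<mu> \<in> wtJ J'" unfolding u(3) mon_wt_wtJ[OF u(2)] by auto
  qed
qed

lemma wtJ_mono: "J \<subseteq> J' \<Longrightarrow> wtJ J \<subseteq> wtJ J'"
  using supp_subset by (auto simp: wtJ_subset_iff)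

text \<open>
  Induction from the right end of a monomial: as long as only nodes of the support have occurred, the
  next letter is added alone, and the definition of \<open>Jmax\<close> applies.
\<close>

lemma supp_below_Jmax:
  assumes "T \<subseteq> Jmax J"
  shows "supp T \<subseteq> supp J"
proof -
  have "set u \<subseteq> supp J" if "u \<in> lists T" "f_mon u \<noteq> 0" for u
    using that
  proof (induction u rule: list.induct)
    case (Cons t u)
    then have "set u \<subseteq> supp J" "t \<in> Jmax J" using assms f_mon_ConsD by auto
    then have "t # u \<in> lists (insert t (supp J))" "wtJ (insert t (supp J)) = wtJ J"
      by (auto simp: Jmax_def)
    then have "t # u \<in> lists J" using mon_wt_wtJ[OF Cons.prems(2)] by metis
    then show ?case using set_supp Cons.prems(2) by blast
  qed simp
  then show ?thesis by (auto simp: supp_def)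
qed

lemma wtJ_eq_iff: "wtJ J = wtJ J' \<longleftrightarrow> supp J \<subseteq> J' \<and> J' \<subseteq> Jmax J"
proof
  assume eq: "wtJ J = wtJ J'"
  then have s: "supp J \<subseteq> J'" using wtJ_subset_iff by blast
  moreover have "J' \<subseteq> Jmax J"
  proof
    fix t assume "t \<in> J'"
    with s have "wtJ (insert t (supp J)) \<subseteq> wtJ J'" by (intro wtJ_mono) auto
    moreover have "wtJ J \<subseteq> wtJ (insert t (supp J))" unfolding wtJ_subset_iff by auto
    ultimately show "t \<in> Jmax J" using eq by (auto simp: Jmax_def)
  qed
  ultimately show "supp J \<subseteq> J' \<and> J' \<subseteq> Jmax J" ..
next
  assume *: "supp J \<subseteq> J' \<and> J' \<subseteq> Jmax J"
  then have "supp J' \<subseteq> J" using supp_below_Jmax supp_subset by blast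
  with * show "wtJ J = wtJ J'" using wtJ_subset_iff by blast
qed

lemma subset_Jmax: "J \<subseteq> Jmax J"
  using wtJ_eq_iff[of J J] by simp

lemma wtJ_Jmax: "wtJ (Jmax J) = wtJ J"
  using wtJ_eq_iff[of J "Jmax J"] subset_Jmax[of J] supp_subset[of J] by auto

text \<open>
  The witness is cut from a monomial over the support and \<open>i\<close> that is not a monomial over \<open>J\<close>: its
  suffix starting at the last occurrence of \<open>i\<close>.
\<close>

lemma outside_Jmax:
  assumes "i \<notin> Jmax J"
  obtains u where "u \<in> lists J" "f_mon (i # u) \<noteq> 0"
proof -
  have "wtJ J \<subseteq> wtJ (insert i (supp J))" unfolding wtJ_subset_iff by auto
  with assms have "\<not> supp (insert i (supp J)) \<subseteq> J" using wtJ_subset_iff by (auto simp: Jmax_def)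
  then obtain x where x: "x \<in> lists (insert i (supp J))" "f_mon x \<noteq> 0" "\<not> set x \<subseteq> J"
    by (auto simp: supp_def)
  then have "\<exists>u\<in>lists J. f_mon (i # u) \<noteq> 0"
  proof (induction x rule: list.induct)
    case (Cons a x)
    show ?case
    proof (cases "set x \<subseteq> J")
      case True
      then have "a = i" using Cons.prems supp_subset[of J] by auto
      with True Cons.prems show ?thesis by (intro bexI[of _ x]) auto
    next
      case False
      with Cons f_mon_ConsD show ?thesis by auto
    qed
  qed simp
  with that show thesis by blast
qed

section \<open>Weyl group elements matching two faces\<close>

text \<open>
  A reflection $s_i$ with $i \in J_{\max}$ changes only the coefficient of $\alpha_i$, so it cannot lead
  out of $\mathrm{wt}_{J_{\max}} V = \mathrm{wt}_J V$ within $\mathrm{wt}\,V$.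
\<close>

lemma refl_stabilizes:
  assumes "i \<in> L \<inter> Jmax J"
  shows "refl i ` wtJ J = wtJ J"
proof -
  have sub: "refl i \<mu> \<in> wtJ J" if \<mu>: "\<mu> \<in> wtJ J" for \<mu>
  proof -
    obtain u where u: "\<mu> = mon_wt u" "u \<in> lists (Jmax J)" "f_mon u \<noteq> 0"
      using \<mu> unfolding wtJ_Jmax[of J, symmetric] wt_J_eq[of "Jmax J"] by blast
    then have "\<mu> \<in> wt K V UNIV" by (auto simp: wt_UNIV_eq)
    then have "refl i \<mu> \<in> wt K V UNIV" using assms refl_weight by blast
    then obtain t where t: "refl i \<mu> = mon_wt t" "f_mon t \<noteq> 0" by (auto simp: wt_UNIV_eq)
    have "set t \<subseteq> Jmax J"
    proof
      fix k assume k: "k \<in> set t"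
      show "k \<in> Jmax J"
      proof (rule ccontr)
        assume nk: "k \<notin> Jmax J"
        have "(\<Sum>j\<in>UNIV. ((of_int (int (count_list u j)) - of_int (int (count_list t j))) +
            (if j = i then \<mu> (coroot i) else 0)) * \<alpha> j h) = 0" for h
        proof -
          have "mon_wt t h = mon_wt u h - \<mu> (coroot i) * \<alpha> i h"
            using t(1) u(1) by (auto simp: refl_def fun_eq_iff)
          then have "root_comb (\<lambda>k. int (count_list u k)) h
              - root_comb (\<lambda>k. int (count_list t k)) h + \<mu> (coroot i) * \<alpha> i h = 0"
            by (simp add: mon_wt_def algebra_simps)
          moreover have "(\<Sum>j\<in>UNIV. (if j = i then \<mu> (coroot i) else 0) * \<alpha> j h) = \<mu> (coroot i) * \<alpha> i h"
            by (subst sum.cong[OF HOL.refl, of UNIV _ "\<lambda>j. if j = i then \<mu> (coroot i) * \<alpha> i h else 0"]) auto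
          ultimately show ?thesis
            by (simp add: root_comb_def ring_distribs sum.distrib sum_subtractf)
        qed
        \<comment> \<open>Comparing coefficients of $\alpha_k$ in $s_i\mu$ and $\mu$.\<close>
        note coeffs = indep[OF this, of k]
        have "k \<noteq> i" using nk assms by auto
        with coeffs have "of_nat (count_list u k) = (of_nat (count_list t k) :: complex)" by simp
        then have "count_list u k = count_list t k" by (simp only: of_nat_eq_iff)
        moreover have "count_list u k = 0" using u(2) nk by (auto simp: count_list_0_iff)
        ultimately show False using k by (simp add: count_list_0_iff)
      qed
    qed
    then have "mon_wt t \<in> wtJ (Jmax J)" using t(2) mon_wt_wtJ by auto
    then show ?thesis using t(1) wtJ_Jmax by simp
  qed
  show ?thesis
  proof
    show "refl i ` wtJ J \<subseteq> wtJ J" using sub by blast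
    show "wtJ J \<subseteq> refl i ` wtJ J" by (metis refl_refl image_eqI subsetI sub)
  qed
qed

lemma word_stabilizes: "s \<in> lists (L \<inter> Jmax J) \<Longrightarrow> word s ` wtJ J = wtJ J"
proof (induction s)
  case (Cons i s)
  have "word (i # s) ` wtJ J = refl i ` (word s ` wtJ J)" by (simp add: image_image)
  then show ?case using Cons refl_stabilizes by simp
qed (simp add: image_def)

text \<open>
  If $i \notin J_{\max}$, then $\alpha_i$ can be subtracted from some $\mu \in \mathrm{wt}_J V$ within
  $\mathrm{wt}\,V$. Its image lies above $w\mu$, hence inside $\mathrm{wt}_{J'} V$, and pulling back
  puts $\mu - \alpha_i$ into $\mathrm{wt}_J V$.
\<close>

lemma nonpos_image_in_Jmax:
  assumes u: "u \<in> lists L" and img: "word u ` wtJ J = wtJ J'"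
    and neg: "nonneg (- word u (\<alpha> i))"
  shows "i \<in> Jmax J"
proof (rule ccontr)
  assume "i \<notin> Jmax J"
  then obtain y where y: "y \<in> lists J" "f_mon (i # y) \<noteq> 0" by (rule outside_Jmax)
  obtain c where c: "\<And>k. 0 \<le> c k" "- word u (\<alpha> i) = root_comb c"
    using neg unfolding nonneg_def by blast
  have "mon_wt y \<in> wtJ J" using y f_mon_ConsD mon_wt_wtJ by blast
  then have "word u (mon_wt y) \<in> wtJ J'" using img by blast
  then obtain s where s: "s \<in> lists J'" "word u (mon_wt y) = mon_wt s" by (auto simp: wt_J_eq)
  have "word u (mon_wt (i # y)) = mon_wt s + root_comb c"
    unfolding mon_wt_Cons word_diff s(2) c(2)[symmetric] by simp
  moreover have "word u (mon_wt (i # y)) \<in> wt K V UNIV"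
    using y(2) by (intro word_weight u) (auto simp: wt_UNIV_eq)
  ultimately obtain t where t: "word u (mon_wt (i # y)) = mon_wt t" "f_mon t \<noteq> 0" "mon_wt s + root_comb c = mon_wt t"
    by (auto simp: wt_UNIV_eq)
  have "set t \<subseteq> set s"
  proof
    fix k assume "k \<in> set t"
    then have "count_list t k \<noteq> 0" by (simp add: count_list_0_iff)
    then have "count_list s k \<noteq> 0" using mon_wt_add_eqD[OF t(3), of k] c(1)[of k] by auto
    then show "k \<in> set s" by (simp add: count_list_0_iff)
  qed
  then have "mon_wt t \<in> wtJ J'" using s(1) t(2) mon_wt_wtJ by auto
  then obtain \<mu> where "\<mu> \<in> wtJ J" "word u \<mu> = mon_wt t" using img by (metis imageE)
  then have "mon_wt (i # y) \<in> wtJ J" using t(1) word_inj by metis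
  then have "i \<in> J" using mon_wt_wtJ[OF y(2)] by simp
  with subset_Jmax \<open>i \<notin> Jmax J\<close> show False by blast
qed

text \<open>
  The last letter of a reduced word has nonpositive image, hence lies in $J_{\max}$ and stabilizes
  $\mathrm{wt}_J V$; without it a shorter element still maps $\mathrm{wt}_J V$ onto
  $\mathrm{wt}_{J'} V$.
\<close>

lemma stabilizer_word:
  assumes "u \<in> lists L" "word u ` wtJ J = wtJ J'"
  shows "\<exists>s\<in>lists (L \<inter> Jmax J). word s = word u"
  using assms
proof (induction "wlen L u" arbitrary: u rule: less_induct)
  case less
  obtain t where t: "t \<in> lists L" "length t = wlen L u" "word t = word u"
    using reduced_word[OF less.prems(1)] .
  show ?case
  proof (cases t rule: rev_cases)
    case Nil
    with t show ?thesis by (intro bexI[of _ "[]"]) auto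
  next
    case (snoc t' i)
    have len: "wlen L (t' @ [i]) = length (t' @ [i])"
      using t wlen_cong[OF t(3)] snoc by simp
    have img: "word (t' @ [i]) ` wtJ J = wtJ J'"
      using t(3) snoc less.prems(2) by simp
    have i: "i \<in> L \<inter> Jmax J"
      using nonpos_image_in_Jmax[OF _ img descent_nonpos[OF _ len]] t(1) snoc by auto
    have "word t' ` wtJ J = word t' ` (refl i ` wtJ J)" using refl_stabilizes[OF i] by simp
    also have "\<dots> = wtJ J'" using img by (simp add: image_image)
    finally have img': "word t' ` wtJ J = wtJ J'" .
    have "t' \<in> lists L" using t(1) snoc by simp
    moreover have "wlen L t' < wlen L u" using wlen_le[OF \<open>t' \<in> lists L\<close>] t(2) snoc by simp
    ultimately obtain s where s: "s \<in> lists (L \<inter> Jmax J)" "word s = word t'"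
      using less.hyps[OF _ _ img'] by blast
    have "word (s @ [i]) = word u"
      using s(2) t(3) snoc by (metis word_append ext)
    with s(1) i show ?thesis by (intro bexI[of _ "s @ [i]"]) auto
  qed
qed

lemma image_eq_iff:
  assumes "u \<in> lists L" "t \<in> lists L"
  shows "word t ` wtJ J' = word u ` wtJ J \<longleftrightarrow>
    wtJ J = wtJ J' \<and> (\<exists>s\<in>lists (L \<inter> Jmax J). word t = word (u @ s))"
proof
  assume eq: "word t ` wtJ J' = word u ` wtJ J"
  have "word (rev t @ u) ` wtJ J = word (rev t) ` (word u ` wtJ J)" by (simp add: image_image)
  also have "\<dots> = wtJ J'" unfolding eq[symmetric] by (simp add: image_image)
  finally have img: "word (rev t @ u) ` wtJ J = wtJ J'" .
  have "rev t @ u \<in> lists L" using assms by auto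
  from stabilizer_word[OF this img]
  obtain s where s: "s \<in> lists (L \<inter> Jmax J)" "word s = word (rev t @ u)"
    by blast
  have "wtJ J = wtJ J'" using img word_stabilizes[OF s(1)] unfolding s(2) by simp
  moreover have "word t \<mu> = word (u @ rev s) \<mu>" for \<mu>
  proof -
    have "\<mu> = word (rev t) (word u (word (rev s) \<mu>))"
      using fun_cong[OF s(2), of "word (rev s) \<mu>"] by simp
    from arg_cong[OF this, of "word t"] show ?thesis by simp
  qed
  then have "word t = word (u @ rev s)" ..
  moreover have "rev s \<in> lists (L \<inter> Jmax J)" using s(1) by auto
  ultimately show "wtJ J = wtJ J' \<and> (\<exists>s\<in>lists (L \<inter> Jmax J). word t = word (u @ s))" by blast
next
  assume "wtJ J = wtJ J' \<and> (\<exists>s\<in>lists (L \<inter> Jmax J). word t = word (u @ s))"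
  then obtain s where s: "wtJ J = wtJ J'" "s \<in> lists (L \<inter> Jmax J)" "word t = word (u @ s)" by blast
  have "word t ` wtJ J' = word u ` (word s ` wtJ J)" unfolding s(3) s(1)[symmetric] by (simp add: image_image)
  then show "word t ` wtJ J' = word u ` wtJ J" using word_stabilizes[OF s(2)] by simp
qed

section \<open>Fibers of the face map\<close>

abbreviation "G \<equiv> BijGroup (hdual K)"

text \<open>
  The extensional bijection of the dual of the Cartan subalgebra that represents a word.
\<close>

definition weyl :: "'i list \<Rightarrow> ('h \<Rightarrow> complex) \<Rightarrow> 'h \<Rightarrow> complex" where
  "weyl u = restrict (word u) (hdual K)"

lemma weyl_carrier: "weyl u \<in> Bij (hdual K)"
  unfolding weyl_def Bij_def
  by (auto intro!: bij_betw_byWitness[where f' = "word (rev u)"] simp: word_hdual cong: bij_betw_cong)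

lemma weyl_mult: "weyl u \<otimes>\<^bsub>G\<^esub> weyl t = weyl (u @ t)"
  using weyl_carrier[of u] weyl_carrier[of t]
  by (auto simp: BijGroup_def compose_def weyl_def word_hdual fun_eq_iff)

lemma weyl_one: "\<one>\<^bsub>G\<^esub> = weyl []"
  by (auto simp: BijGroup_def weyl_def fun_eq_iff)

lemma weyl_simple: "simple_refl K i = weyl [i]"
  by (auto simp: simple_refl_def weyl_def refl_def fun_eq_iff)

lemma weyl_inv: "inv\<^bsub>G\<^esub> weyl u = weyl (rev u)"
proof -
  interpret group G by (rule group_BijGroup)
  show ?thesis
  proof (rule inv_equality)
    show "weyl (rev u) \<otimes>\<^bsub>G\<^esub> weyl u = \<one>\<^bsub>G\<^esub>"
      unfolding weyl_mult weyl_one by (auto simp: weyl_def fun_eq_iff)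
  qed (use weyl_carrier in \<open>auto simp: BijGroup_def\<close>)
qed

lemma weyl_parabolic_words: "weyl_parabolic K J = weyl ` lists J"
proof (intro equalityI subsetI)
  fix w assume "w \<in> weyl_parabolic K J"
  then show "w \<in> weyl ` lists J"
    unfolding weyl_parabolic_def
  proof (induction rule: generate.induct)
    case one
    show ?case unfolding weyl_one by auto
  next
    case (incl h)
    then show ?case by (auto simp: weyl_simple)
  next
    case (inv h)
    then show ?case by (auto simp: weyl_simple weyl_inv)
  next
    case (eng h1 h2)
    then obtain u t where ut: "h1 = weyl u" "h2 = weyl t" "u @ t \<in> lists J" by auto
    show ?case unfolding ut(1,2) weyl_mult by (rule imageI) (rule ut(3))
  qed
next
  fix w assume "w \<in> weyl ` lists J"
  then obtain u where "u \<in> lists J" "w = weyl u" by blast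
  moreover have "u \<in> lists J \<Longrightarrow> weyl u \<in> weyl_parabolic K J" for u
    unfolding weyl_parabolic_def
  proof (induction u)
    case Nil
    show ?case using generate.one[of G] by (simp add: weyl_one)
  next
    case (Cons i u)
    then have "weyl [i] \<in> generate G (simple_refl K ` J)"
      by (intro generate.incl) (auto simp: weyl_simple)
    from generate.eng[OF this Cons.IH] Cons.prems show ?case by (simp add: weyl_mult)
  qed
  ultimately show "w \<in> weyl_parabolic K J" by blast
qed

lemma weyl_coset: "weyl u <#\<^bsub>G\<^esub> weyl_parabolic K J = {weyl (u @ s) |s. s \<in> lists J}"
  by (auto simp: l_coset_def weyl_parabolic_words weyl_mult)

lemma face_map_weyl: "face_map K V \<Lambda> (weyl u, J) = word u ` wtJ J"
proof -
  have "wtJ J \<subseteq> hdual K" by (auto simp: wt_J_def wt_def)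
  then show ?thesis by (auto simp: face_map_def weyl_def subset_iff image_iff)
qed

lemma fibre:
  assumes "w \<in> weyl_parabolic K L"
  shows "w' \<in> weyl_parabolic K L \<and> face_map K V \<Lambda> (w', J') = face_map K V \<Lambda> (w, J) \<longleftrightarrow>
    w' \<in> w <#\<^bsub>G\<^esub> weyl_parabolic K (L \<inter> Jmax J) \<and> J' \<in> {supp J..Jmax J}"
proof -
  obtain u where u: "u \<in> lists L" "w = weyl u" using assms by (auto simp: weyl_parabolic_words)
  show ?thesis
  proof
    assume *: "w' \<in> weyl_parabolic K L \<and> face_map K V \<Lambda> (w', J') = face_map K V \<Lambda> (w, J)"
    then obtain t where t: "t \<in> lists L" "w' = weyl t" unfolding weyl_parabolic_words by blast
    have "word t ` wtJ J' = word u ` wtJ J" using * unfolding t(2) u(2) face_map_weyl by blast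
    from iffD1[OF image_eq_iff[OF u(1) t(1)] this]
    obtain s where s: "wtJ J = wtJ J'" "s \<in> lists (L \<inter> Jmax J)" "word t = word (u @ s)" by blast
    have "weyl t = weyl (u @ s)" unfolding weyl_def s(3) ..
    then show "w' \<in> w <#\<^bsub>G\<^esub> weyl_parabolic K (L \<inter> Jmax J) \<and> J' \<in> {supp J..Jmax J}"
      using s(2) s(1)[unfolded wtJ_eq_iff] unfolding u(2) weyl_coset t(2) by auto
  next
    assume "w' \<in> w <#\<^bsub>G\<^esub> weyl_parabolic K (L \<inter> Jmax J) \<and> J' \<in> {supp J..Jmax J}"
    then obtain s where s: "w' = weyl (u @ s)" "s \<in> lists (L \<inter> Jmax J)" "wtJ J = wtJ J'"
      unfolding u(2) weyl_coset by (auto simp: wtJ_eq_iff)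
    have us: "u @ s \<in> lists L" using u s by auto
    moreover have "word (u @ s) ` wtJ J' = word u ` wtJ J"
      using s by (intro iffD2[OF image_eq_iff[OF u(1) us]]) blast
    ultimately show "w' \<in> weyl_parabolic K L \<and> face_map K V \<Lambda> (w', J') = face_map K V \<Lambda> (w, J)"
      unfolding s(1) u(2) face_map_weyl weyl_parabolic_words by blast
  qed
qed

lemma face_map_range: "face_map K V \<Lambda> \<in> weyl_parabolic K L \<times> UNIV \<rightarrow> Pow (wt K V UNIV)"
proof (rule funcsetI)
  fix p assume "p \<in> weyl_parabolic K L \<times> (UNIV :: 'i set set)"
  then obtain u J where u: "u \<in> lists L" "p = (weyl u, J)" unfolding weyl_parabolic_words by blast
  have "wtJ J \<subseteq> wt K V UNIV" by (auto simp: wt_J_eq wt_UNIV_eq)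
  then have "word u ` wtJ J \<subseteq> wt K V UNIV" using word_weight[OF u(1)] by blast
  then show "face_map K V \<Lambda> p \<in> Pow (wt K V UNIV)" unfolding u(2) face_map_weyl by blast
qed

end

theorem theorem2p2:
  fixes K :: "('i::finite, 'h::ab_group_add, 'g::ab_group_add) kac_moody_data"
    and V :: "('g, 'v::ab_group_add) lie_module"
    and \<Lambda> :: "'h \<Rightarrow> complex"
  assumes "kac_moody_algebra K"
    and "highest_weight_module K V \<Lambda>"
  shows
    "face_map K V \<Lambda> \<in>
       weyl_parabolic K (integrable_nodes K V) \<times> UNIV \<rightarrow> Pow (wt K V UNIV) \<and>
     (\<forall>J. \<exists>Jmin Jmax. Jmin \<subseteq> J \<and> J \<subseteq> Jmax \<and>
       (\<forall>J'. wt_J K V \<Lambda> J \<subseteq> wt_J K V \<Lambda> J' \<longleftrightarrow> Jmin \<subseteq> J') \<and>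
       (\<forall>J'. wt_J K V \<Lambda> J = wt_J K V \<Lambda> J' \<longleftrightarrow> Jmin \<subseteq> J' \<and> J' \<subseteq> Jmax) \<and>
       {J'. face_map K V \<Lambda> (\<one>\<^bsub>BijGroup (hdual K)\<^esub>, J') =
            face_map K V \<Lambda> (\<one>\<^bsub>BijGroup (hdual K)\<^esub>, J)} = {Jmin..Jmax} \<and>
       (\<forall>w \<in> weyl_parabolic K (integrable_nodes K V).
          {w' \<in> weyl_parabolic K (integrable_nodes K V).
             face_map K V \<Lambda> (w', J) = face_map K V \<Lambda> (w, J)} =
          w <#\<^bsub>BijGroup (hdual K)\<^esub> weyl_parabolic K (integrable_nodes K V \<inter> Jmax)) \<and>
       (faces_conjugate_to_standard K V \<Lambda> \<longrightarrow>
         (\<forall>w \<in> weyl_parabolic K (integrable_nodes K V).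
            {(w', J'). w' \<in> weyl_parabolic K (integrable_nodes K V) \<and>
               face_map K V \<Lambda> (w', J') = face_map K V \<Lambda> (w, J)} =
            (w <#\<^bsub>BijGroup (hdual K)\<^esub> weyl_parabolic K (integrable_nodes K V \<inter> Jmax))
              \<times> {Jmin..Jmax})))"
proof -
  obtain v where v: "v \<noteq> 0" "v \<in> weight_space K V \<Lambda>" "\<forall>x\<in>n_plus K. act V x v = 0"
    "U_apply V UNIV {v} = UNIV" and "g_module K V" "\<Lambda> \<in> hdual K"
    using assms(2) unfolding highest_weight_module_def by blast
  then interpret highest_weight_setting K V \<Lambda> v
    using assms(1) by unfold_locales auto
  have J_in: "J \<in> {supp J..Jmax J}" for J
    using supp_subset subset_Jmax by auto
  have identity: "{J'. face_map K V \<Lambda> (\<one>\<^bsub>G\<^esub>, J') = face_map K V \<Lambda> (\<one>\<^bsub>G\<^esub>, J)} = {supp J..Jmax J}" for J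
  proof -
    have "face_map K V \<Lambda> (\<one>\<^bsub>G\<^esub>, J') = wtJ J'" for J'
      unfolding weyl_one face_map_weyl by simp
    then have "?thesis \<longleftrightarrow> {J'. wtJ J = wtJ J'} = {supp J..Jmax J}" by (simp add: eq_commute)
    then show ?thesis by (auto simp: wtJ_eq_iff)
  qed
  show ?thesis
  proof (intro conjI allI face_map_range)
    fix J
    show "\<exists>Jmin Jmax. Jmin \<subseteq> J \<and> J \<subseteq> Jmax \<and>
       (\<forall>J'. wtJ J \<subseteq> wtJ J' \<longleftrightarrow> Jmin \<subseteq> J') \<and>
       (\<forall>J'. wtJ J = wtJ J' \<longleftrightarrow> Jmin \<subseteq> J' \<and> J' \<subseteq> Jmax) \<and>
       {J'. face_map K V \<Lambda> (\<one>\<^bsub>G\<^esub>, J') = face_map K V \<Lambda> (\<one>\<^bsub>G\<^esub>, J)} = {Jmin..Jmax} \<and>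
       (\<forall>w \<in> weyl_parabolic K L.
          {w' \<in> weyl_parabolic K L. face_map K V \<Lambda> (w', J) = face_map K V \<Lambda> (w, J)} =
          w <#\<^bsub>G\<^esub> weyl_parabolic K (L \<inter> Jmax)) \<and>
       (faces_conjugate_to_standard K V \<Lambda> \<longrightarrow>
         (\<forall>w \<in> weyl_parabolic K L.
            {(w', J'). w' \<in> weyl_parabolic K L \<and> face_map K V \<Lambda> (w', J') = face_map K V \<Lambda> (w, J)} =
            (w <#\<^bsub>G\<^esub> weyl_parabolic K (L \<inter> Jmax)) \<times> {Jmin..Jmax}))"
    proof (rule exI[of _ "supp J"], rule exI[of _ "Jmax J"], intro conjI ballI impI allI)
      fix w assume w: "w \<in> weyl_parabolic K L"
      show "{w' \<in> weyl_parabolic K L. face_map K V \<Lambda> (w', J) = face_map K V \<Lambda> (w, J)} =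
          w <#\<^bsub>G\<^esub> weyl_parabolic K (L \<inter> Jmax J)"
        using fibre[OF w] J_in by blast
      show "{(w', J'). w' \<in> weyl_parabolic K L \<and> face_map K V \<Lambda> (w', J') = face_map K V \<Lambda> (w, J)} =
            (w <#\<^bsub>G\<^esub> weyl_parabolic K (L \<inter> Jmax J)) \<times> {supp J..Jmax J}"
        using fibre[OF w] by blast
    qed (rule supp_subset subset_Jmax identity wtJ_subset_iff wtJ_eq_iff)+
  qed
qed

end
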